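(* Let $\mathcal{H}_S\simeq\mathbb{C}^d$. (1) Let $\Phi:\mathcal{B}(\mathcal{H}_S)\to\mathcal{B}(\mathcal{H}_S)$ be a completely positive, not necessarily trace-preserving map with Kraus operators $K^{(1)},\dots,K^{(r)}$, $r\le d^2$, so that $\Phi(\rho)=\sum_{i=1}^rK^{(i)}\rho (K^{(i)})^\dagger$. Let $G=\sum_{i=1}^r(K^{(i)})^\dagger K^{(i)}$, let $g$ be the largest eigenvalue of $G$, and set $c=1$ if $g\le1$ and $c=g$ if $g>1$. Then there exist an operator $K^{(\infty)}$ on $\mathcal{H}_S$ with $\frac1cG+(K^{(\infty)})^\dagger K^{(\infty)}=\mathds{1}$ and a unitary $U$ on $\mathcal{H}_E\otimes\mathcal{H}_S$, $\mathcal{H}_E=\mathbb{C}^{r+1}$, whose first block column, with respect to the standard basis $|1\rangle,\dots,|r+1\rangle$ of $\mathcal{H}_E$, consists of the blocks $\frac{1}{\sqrt c}K^{(1)},\dots,\frac1{\sqrt c}K^{(r)},K^{(\infty)}$, such that, with the projector $P_1=\sum_{j=1}^r|j\rangle\langle j|\otimes\mathds{1}_{\mathcal{H}_S}$, for every density operator $\rho$ on $\mathcal{H}_S$ $$\Phi(\rho)=c\;\mathrm{Tr}_E\big[P_1U(|1\rangle\langle1|\otimes\rho)U^\dagger P_1\big].$$ Consequently, if $p=\mathrm{Tr}[P_1U(|1\rangle\langle1|\otimes\rho)U^\dagger P_1]$ is the probability of outcome $1$ of the measurement $\{P_1,\mathds{1}-P_1\}$ and $p>0$, then the reduced post-measurement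 state $\rho'=\frac1p\mathrm{Tr}_E[P_1U(|1\rangle\langle1|\otimes\rho)U^\dagger P_1]$ satisfies $$\mathrm{Tr}[A\,\Phi(\rho)]=c\,p\,\mathrm{Tr}[A\rho']\qquad\text{for all }A\in\mathcal{B}(\mathcal{H}_S).$$ (2) If $T:\mathcal{B}(\mathcal{H}_S)\to\mathcal{B}(\mathcal{H}_S)$ is Hermiticity-preserving and trace-preserving (not necessarily positive), then there are completely positive, not necessarily trace-preserving maps $T^{(0)},T^{(1)}$ with $T=T^{(0)}-T^{(1)}$; hence, applying (1) to $\Phi=T^{(0)}$ and $\Phi=T^{(1)}$, with corresponding $c_x,p_x,\rho'_x$ for $x=0,1$ and both $p_x>0$, every expectation value after $T$ is recovered as $$\mathrm{Tr}[A\,T(\rho)]=c_0\,p_0\,\mathrm{Tr}[A\rho'_0]-c_1\,p_1\,\mathrm{Tr}[A\rho'_1].$$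
   Context: $\mathcal{B}(\mathcal{H}_S)$ denotes the linear operators on the finite-dimensional Hilbert space $\mathcal{H}_S$, and $\mathrm{Tr}_E$ is the partial trace over $\mathcal{H}_E$. The result says that any Hermiticity- and trace-preserving map can be implemented algorithmically, at the level of expectation values, by unitary operations and measurements on a dilated space. *)

theory Defs
  imports
    "Jordan_Normal_Form.Schur_Decomposition"
    "Jordan_Normal_Form.Char_Poly"
begin

text \<open>
  Operators on \<open>\<complex>\<^sup>n\<close> are complex \<open>n \<times> n\<close> matrices in the standard basis, with indices
  starting at \<open>0\<close>. On \<open>\<complex>\<^sup>n \<otimes> \<complex>\<^sup>d\<close> the basis vector \<open>|i\<rangle> \<otimes> |a\<rangle>\<close> has
  index \<open>i * d + a\<close>. Inequalities between complex numbers are those of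
  \<^theory>\<open>HOL-Library.Complex_Order\<close>: \<open>0 \<le> z\<close> says that \<open>z\<close> is real and nonnegative.
\<close>

section \<open>Matrices\<close>

definition mat_trace :: "complex mat \<Rightarrow> complex" where
  "mat_trace A = (\<Sum>i<dim_row A. A $$ (i, i))"

definition sum_mats :: "nat \<Rightarrow> nat \<Rightarrow> (nat \<Rightarrow> complex mat) \<Rightarrow> complex mat" where
  "sum_mats n m F = mat n n (\<lambda>ij. \<Sum>k<m. F k $$ ij)"

definition hermitian_mat :: "complex mat \<Rightarrow> bool" where
  "hermitian_mat A \<longleftrightarrow> mat_adjoint A = A"

definition unitary_mat :: "nat \<Rightarrow> complex mat \<Rightarrow> bool" where
  "unitary_mat n U \<longleftrightarrow>
     U \<in> carrier_mat n n \<and> mat_adjoint U * U = 1\<^sub>m n \<and> U * mat_adjoint U = 1\<^sub>m n"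

definition positive_mat :: "nat \<Rightarrow> complex mat \<Rightarrow> bool" where
  "positive_mat n A \<longleftrightarrow>
     A \<in> carrier_mat n n \<and> (\<forall>v \<in> carrier_vec n. 0 \<le> (A *\<^sub>v v) \<bullet>c v)"

definition density_operator :: "nat \<Rightarrow> complex mat \<Rightarrow> bool" where
  "density_operator n \<rho> \<longleftrightarrow> positive_mat n \<rho> \<and> mat_trace \<rho> = 1"

text \<open>Only used for Hermitian matrices of positive dimension, whose eigenvalues are all real.\<close>

definition largest_eigenvalue :: "complex mat \<Rightarrow> real" where
  "largest_eigenvalue A = Max {x. eigenvalue A (complex_of_real x)}"

section \<open>Tensor products\<close>

definition tensor_mat :: "complex mat \<Rightarrow> complex mat \<Rightarrow> complex mat" (infixr \<open>\<otimes>\<^sub>m\<close> 75) where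
  "A \<otimes>\<^sub>m B = mat (dim_row A * dim_row B) (dim_col A * dim_col B)
     (\<lambda>(k, l). A $$ (k div dim_row B, l div dim_col B) * B $$ (k mod dim_row B, l mod dim_col B))"

text \<open>The operator \<open>|i\<rangle>\<langle>j|\<close> on \<open>\<complex>\<^sup>n\<close>.\<close>

definition ket_bra :: "nat \<Rightarrow> nat \<Rightarrow> nat \<Rightarrow> complex mat" where
  "ket_bra n i j = mat n n (\<lambda>(k, l). if k = i \<and> l = j then 1 else 0)"

text \<open>The \<open>d \<times> d\<close> block \<open>(\<langle>i| \<otimes> 1) X (|j\<rangle> \<otimes> 1)\<close>.\<close>

definition mat_block :: "nat \<Rightarrow> complex mat \<Rightarrow> nat \<Rightarrow> nat \<Rightarrow> complex mat" where
  "mat_block d X i j = mat d d (\<lambda>(a, b). X $$ (i * d + a, j * d + b))"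

text \<open>The partial trace over the first factor of \<open>\<complex>\<^sup>n \<otimes> \<complex>\<^sup>d\<close>.\<close>

definition partial_trace :: "nat \<Rightarrow> nat \<Rightarrow> complex mat \<Rightarrow> complex mat" where
  "partial_trace n d X = sum_mats d n (\<lambda>i. mat_block d X i i)"

section \<open>Linear maps on operators\<close>

definition linear_superop :: "nat \<Rightarrow> (complex mat \<Rightarrow> complex mat) \<Rightarrow> bool" where
  "linear_superop d \<Phi> \<longleftrightarrow>
     (\<forall>X \<in> carrier_mat d d. \<Phi> X \<in> carrier_mat d d) \<and>
     (\<forall>X \<in> carrier_mat d d. \<forall>Y \<in> carrier_mat d d. \<Phi> (X + Y) = \<Phi> X + \<Phi> Y) \<and>
     (\<forall>a. \<forall>X \<in> carrier_mat d d. \<Phi> (a \<cdot>\<^sub>m X) = a \<cdot>\<^sub>m \<Phi> X)"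

text \<open>The map \<open>id \<otimes> \<Phi>\<close> on operators on \<open>\<complex>\<^sup>n \<otimes> \<complex>\<^sup>d\<close>, i.e. \<open>\<Phi>\<close> applied to every block.\<close>

definition ampliation ::
  "nat \<Rightarrow> nat \<Rightarrow> (complex mat \<Rightarrow> complex mat) \<Rightarrow> complex mat \<Rightarrow> complex mat" where
  "ampliation n d \<Phi> X = mat (n * d) (n * d)
     (\<lambda>(k, l). \<Phi> (mat_block d X (k div d) (l div d)) $$ (k mod d, l mod d))"

definition completely_positive :: "nat \<Rightarrow> (complex mat \<Rightarrow> complex mat) \<Rightarrow> bool" where
  "completely_positive d \<Phi> \<longleftrightarrow> linear_superop d \<Phi> \<and>
     (\<forall>n X. positive_mat (n * d) X \<longrightarrow> positive_mat (n * d) (ampliation n d \<Phi> X))"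

definition hermiticity_preserving :: "nat \<Rightarrow> (complex mat \<Rightarrow> complex mat) \<Rightarrow> bool" where
  "hermiticity_preserving d T \<longleftrightarrow>
     (\<forall>X \<in> carrier_mat d d. hermitian_mat X \<longrightarrow> hermitian_mat (T X))"

definition trace_preserving :: "nat \<Rightarrow> (complex mat \<Rightarrow> complex mat) \<Rightarrow> bool" where
  "trace_preserving d T \<longleftrightarrow> (\<forall>X \<in> carrier_mat d d. mat_trace (T X) = mat_trace X)"

section \<open>Kraus operators and their dilation\<close>

text \<open>\<open>K 0, \<dots>, K (r - 1)\<close> are Kraus operators of \<open>\<Phi>\<close>; other values of \<open>K\<close> are irrelevant.\<close>

definition kraus_operators ::
  "nat \<Rightarrow> (complex mat \<Rightarrow> complex mat) \<Rightarrow> nat \<Rightarrow> (nat \<Rightarrow> complex mat) \<Rightarrow> bool" where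
  "kraus_operators d \<Phi> r K \<longleftrightarrow>
     r \<le> d\<^sup>2 \<and> (\<forall>i<r. K i \<in> carrier_mat d d) \<and>
     (\<forall>\<rho> \<in> carrier_mat d d. \<Phi> \<rho> = sum_mats d r (\<lambda>i. K i * \<rho> * mat_adjoint (K i)))"

definition kraus_gram :: "nat \<Rightarrow> nat \<Rightarrow> (nat \<Rightarrow> complex mat) \<Rightarrow> complex mat" where
  "kraus_gram d r K = sum_mats d r (\<lambda>i. mat_adjoint (K i) * K i)"

definition kraus_scale :: "nat \<Rightarrow> nat \<Rightarrow> (nat \<Rightarrow> complex mat) \<Rightarrow> real" where
  "kraus_scale d r K =
     (let g = largest_eigenvalue (kraus_gram d r K) in if g \<le> 1 then 1 else g)"

text \<open>
  \<open>Kinf\<close> completes the rescaled Kraus operators, and \<open>U\<close> is a unitary on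
  \<open>\<complex>\<^sup>r\<^sup>+\<^sup>1 \<otimes> \<complex>\<^sup>d\<close> with them as its first block column.
\<close>

definition kraus_dilation ::
  "nat \<Rightarrow> nat \<Rightarrow> (nat \<Rightarrow> complex mat) \<Rightarrow> complex mat \<Rightarrow> complex mat \<Rightarrow> bool" where
  "kraus_dilation d r K Kinf U \<longleftrightarrow>
     (let c = kraus_scale d r K in
       Kinf \<in> carrier_mat d d \<and>
       complex_of_real (1 / c) \<cdot>\<^sub>m kraus_gram d r K + mat_adjoint Kinf * Kinf = 1\<^sub>m d \<and>
       unitary_mat ((r + 1) * d) U \<and>
       (\<forall>i<r. mat_block d U i 0 = complex_of_real (1 / sqrt c) \<cdot>\<^sub>m K i) \<and>
       mat_block d U r 0 = Kinf)"

section \<open>The measurement\<close>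

definition outcome_projector :: "nat \<Rightarrow> nat \<Rightarrow> complex mat" where
  "outcome_projector d r = sum_mats ((r + 1) * d) r (\<lambda>j. ket_bra (r + 1) j j \<otimes>\<^sub>m 1\<^sub>m d)"

text \<open>The unnormalised state after outcome 1.\<close>

definition outcome_operator :: "nat \<Rightarrow> nat \<Rightarrow> complex mat \<Rightarrow> complex mat \<Rightarrow> complex mat" where
  "outcome_operator d r U \<rho> =
     outcome_projector d r * U * (ket_bra (r + 1) 0 0 \<otimes>\<^sub>m \<rho>) * mat_adjoint U * outcome_projector d r"

definition outcome_prob :: "nat \<Rightarrow> nat \<Rightarrow> complex mat \<Rightarrow> complex mat \<Rightarrow> complex" where
  "outcome_prob d r U \<rho> = mat_trace (outcome_operator d r U \<rho>)"

definition post_state :: "nat \<Rightarrow> nat \<Rightarrow> complex mat \<Rightarrow> complex mat \<Rightarrow> complex mat" where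
  "post_state d r U \<rho> =
     (1 / outcome_prob d r U \<rho>) \<cdot>\<^sub>m partial_trace (r + 1) d (outcome_operator d r U \<rho>)"

end

theory Submission
  imports Defs "Jordan_Normal_Form.Spectral_Radius"
begin

text \<open>
  Complex Householder reflections move one orthonormal vector at a time. They complete an isometry
  to a unitary, and they diagonalise a Hermitian matrix \<open>A\<close>; hence \<open>a + b A\<close> is of the form \<open>W\<^sup>* W\<close> as
  soon as \<open>a + b x\<close> is nonnegative on the spectrum. For \<open>1 - G / c\<close> this gives \<open>K\<^sup>(\<^sup>\<infinity>\<^sup>)\<close>, and the block
  column of the rescaled Kraus operators becomes an isometry. For the Choi matrix \<open>C\<close> of \<open>T\<close>,
  which is Hermitian, it applies to \<open>C + a\<close> and to the constant \<open>a\<close> with \<open>a\<close> large, which are the Choi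
  matrices of \<open>T\<^sup>(\<^sup>0\<^sup>) = T + a Tr(\<cdot>) 1\<close> and \<open>T\<^sup>(\<^sup>1\<^sup>) = a Tr(\<cdot>) 1\<close>; the rows of \<open>W\<close> are their \<open>d\<^sup>2\<close> Kraus operators.
\<close>

section \<open>Unitary and Hermitian matrices\<close>

text \<open>Both halves only call for a factorisation \<open>mat_adjoint W * W\<close>, never for a
  positive square root; W can therefore be a diagonal root times the adjoint of an eigenbasis. The
  scale c bounds the spectrum of G, which is what makes 1 - G / c positive semidefinite; it stays 1
  when no rescaling is called for. In the splitting, the Choi matrix is not separated into positive
  and negative parts: the map Tr(.) 1 has the identity as its Choi matrix, so adding a multiple of
  it merely translates the spectrum. The recovery formula reads off only the first block column of
  U. The choice of the remaining columns is thus harmless, and the second half can be claimed for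
  all Kraus families and all dilations of \<open>T0\<close> and \<open>T1\<close>, not only for the
  constructed ones.\<close>

lemma carrier_mat_adjoint [simp]: "A \<in> carrier_mat n m \<Longrightarrow> mat_adjoint A \<in> carrier_mat m n"
  by (auto simp: mat_adjoint_def)

lemma dim_mat_adjoint [simp]:
  "dim_row (mat_adjoint A) = dim_col A" "dim_col (mat_adjoint A) = dim_row A"
  by (auto simp: mat_adjoint_def)

lemma index_mat_adjoint [simp]:
  fixes A :: "complex mat"
  assumes "i < dim_col A" "j < dim_row A"
  shows "mat_adjoint A $$ (i, j) = cnj (A $$ (j, i))"
  using assms by (auto simp: mat_adjoint_def mat_of_rows_index)

lemma index_mult_mat_sum:
  assumes "A \<in> carrier_mat n m" "B \<in> carrier_mat m p" "i < n" "j < p"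
  shows "(A * B) $$ (i, j) = (\<Sum>k<m. A $$ (i, k) * B $$ (k, j))"
  using assms by (auto simp: scalar_prod_def atLeast0LessThan intro!: sum.cong)

lemma index_mult_vec_sum:
  assumes "A \<in> carrier_mat n m" "v \<in> carrier_vec m" "i < n"
  shows "(A *\<^sub>v v) $ i = (\<Sum>k<m. A $$ (i, k) * v $ k)"
  using assms by (auto simp: scalar_prod_def atLeast0LessThan intro!: sum.cong)

lemma cscalar_prod_sum:
  fixes v w :: "complex vec"
  assumes "w \<in> carrier_vec n"
  shows "v \<bullet>c w = (\<Sum>k<n. v $ k * cnj (w $ k))"
  using assms by (auto simp: scalar_prod_def atLeast0LessThan intro!: sum.cong)

lemma mat_adjoint_adjoint [simp]:
  fixes A :: "complex mat"
  shows "mat_adjoint (mat_adjoint A) = A"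
  by (rule eq_matI) auto

lemma mat_adjoint_mult:
  fixes A B :: "complex mat"
  assumes "A \<in> carrier_mat n m" "B \<in> carrier_mat m p"
  shows "mat_adjoint (A * B) = mat_adjoint B * mat_adjoint A"
proof (rule eq_matI)
  fix i j
  assume "i < dim_row (mat_adjoint B * mat_adjoint A)" "j < dim_col (mat_adjoint B * mat_adjoint A)"
  then have i: "i < p" and j: "j < n" using assms by auto
  have "mat_adjoint (A * B) $$ (i, j) = cnj ((A * B) $$ (j, i))"
    using assms i j by (intro index_mat_adjoint) auto
  also have "\<dots> = (\<Sum>k<m. mat_adjoint B $$ (i, k) * mat_adjoint A $$ (k, j))"
    using assms i j by (auto simp: index_mult_mat_sum[OF assms] mult.commute simp del: index_mult_mat)
  also have "\<dots> = (mat_adjoint B * mat_adjoint A) $$ (i, j)"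
    using assms i j by (subst index_mult_mat_sum[of _ p m _ n]) auto
  finally show "mat_adjoint (A * B) $$ (i, j) = (mat_adjoint B * mat_adjoint A) $$ (i, j)" .
qed (use assms in auto)

lemma cscalar_prod_adjoint:
  fixes A :: "complex mat"
  assumes "A \<in> carrier_mat n m" "v \<in> carrier_vec m" "w \<in> carrier_vec n"
  shows "(A *\<^sub>v v) \<bullet>c w = v \<bullet>c (mat_adjoint A *\<^sub>v w)"
proof -
  have "(A *\<^sub>v v) \<bullet>c w = (\<Sum>i<n. \<Sum>k<m. A $$ (i, k) * v $ k * cnj (w $ i))"
    using assms by (auto simp: cscalar_prod_sum[of w n] index_mult_vec_sum[OF assms(1,2)]
        sum_distrib_right simp del: index_mult_mat_vec)
  also have "\<dots> = (\<Sum>k<m. \<Sum>i<n. v $ k * cnj (mat_adjoint A $$ (k, i) * w $ i))"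
    using assms by (subst sum.swap) (auto intro!: sum.cong)
  also have "\<dots> = v \<bullet>c (mat_adjoint A *\<^sub>v w)"
    using assms by (subst cscalar_prod_sum[of _ m])
      (auto simp: index_mult_vec_sum[of "mat_adjoint A" m n] sum_distrib_left intro!: mult_mat_vec_carrier
        simp del: index_mult_mat_vec)
  finally show ?thesis .
qed

text \<open>For square matrices a left inverse is also a right inverse, so one of the two equations
  in \<open>unitary_mat\<close> is enough.\<close>

lemma unitary_matI:
  assumes "U \<in> carrier_mat n n" "mat_adjoint U * U = 1\<^sub>m n"
  shows "unitary_mat n U"
  using assms mat_mult_left_right_inverse[of "mat_adjoint U" n U]
  by (auto simp: unitary_mat_def)

lemma unitary_mat_mult:
  assumes "unitary_mat n U" "unitary_mat n V"
  shows "unitary_mat n (U * V)"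
proof (rule unitary_matI)
  have U: "U \<in> carrier_mat n n" "mat_adjoint U * U = 1\<^sub>m n"
    and V: "V \<in> carrier_mat n n" "mat_adjoint V * V = 1\<^sub>m n"
    using assms by (auto simp: unitary_mat_def)
  show "U * V \<in> carrier_mat n n" using U V by auto
  have "mat_adjoint (U * V) * (U * V) = mat_adjoint V * mat_adjoint U * (U * V)"
    using U V by (simp add: mat_adjoint_mult[of _ n n _ n])
  also have "\<dots> = mat_adjoint V * (mat_adjoint U * (U * V))"
    using U V by (intro assoc_mult_mat[of _ n n _ n _ n]) auto
  also have "mat_adjoint U * (U * V) = mat_adjoint U * U * V"
    using U V by (intro assoc_mult_mat[of _ n n _ n _ n, symmetric]) auto
  finally show "mat_adjoint (U * V) * (U * V) = 1\<^sub>m n" using U V by simp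
qed

lemma unitary_mat_adjoint_mult_vec:
  assumes "unitary_mat n U" "v \<in> carrier_vec n"
  shows "mat_adjoint U *\<^sub>v (U *\<^sub>v v) = v" "U *\<^sub>v (mat_adjoint U *\<^sub>v v) = v"
  using assms assoc_mult_mat_vec[of "mat_adjoint U" n n U n v]
    assoc_mult_mat_vec[of U n n "mat_adjoint U" n v]
  by (auto simp: unitary_mat_def)

lemma unitary_cscalar_prod:
  assumes "unitary_mat n U" "v \<in> carrier_vec n" "w \<in> carrier_vec n"
  shows "(U *\<^sub>v v) \<bullet>c (U *\<^sub>v w) = v \<bullet>c w"
  using assms cscalar_prod_adjoint[of U n n v "U *\<^sub>v w"] unitary_mat_adjoint_mult_vec(1)[of n U w]
  by (auto simp: unitary_mat_def)

lemma unitary_adjoint: "unitary_mat n U \<Longrightarrow> unitary_mat n (mat_adjoint U)"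
  by (auto simp: unitary_mat_def)

lemma unitary_one_mat: "unitary_mat n (1\<^sub>m n)"
proof (rule unitary_matI)
  have "mat_adjoint (1\<^sub>m n :: complex mat) = 1\<^sub>m n" by (rule eq_matI) auto
  then show "mat_adjoint (1\<^sub>m n) * 1\<^sub>m n = (1\<^sub>m n :: complex mat)" by simp
qed simp

text \<open>
  With \<open>u = x - y\<close> and \<open>\<alpha> = \<langle>u, x\<rangle> = 1 - \<langle>y, x\<rangle>\<close> the matrix \<open>1 - u u\<^sup>* / \<alpha>\<close> sends \<open>x\<close> to \<open>y\<close>; it is
  unitary because \<open>\<langle>u, u\<rangle> = \<alpha> + cnj \<alpha>\<close>. Dividing by \<open>\<alpha>\<close> instead of \<open>\<langle>u, u\<rangle> / 2\<close> makes a phase correction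
  superfluous.
\<close>

lemma complex_householder:
  fixes x y :: "complex vec"
  assumes x: "x \<in> carrier_vec n" "x \<bullet>c x = 1" and y: "y \<in> carrier_vec n" "y \<bullet>c y = 1"
  shows "\<exists>H. unitary_mat n H \<and> H *\<^sub>v x = y \<and>
           (\<forall>z \<in> carrier_vec n. z \<bullet>c x = 0 \<and> z \<bullet>c y = 0 \<longrightarrow> H *\<^sub>v z = z)"
proof (cases "x = y")
  case True
  then show ?thesis using unitary_one_mat x by (intro exI[of _ "1\<^sub>m n"]) auto
next
  case False
  define u where "u = x - y"
  define a where "a = 1 / (x \<bullet>c u)"
  have u: "u \<in> carrier_vec n" using x y by (auto simp: u_def)
  have xu: "x \<bullet>c u = 1 - x \<bullet>c y"
    using x y by (auto simp: u_def cscalar_prod_sum[of _ n] algebra_simps sum_subtractf)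
  have yx: "cnj (x \<bullet>c y) = y \<bullet>c x"
    using x y by (auto simp: cscalar_prod_sum[of _ n] mult.commute)
  have uu: "u \<bullet>c u = x \<bullet>c u + cnj (x \<bullet>c u)"
    unfolding xu complex_cnj_diff yx using x y
    by (auto simp: u_def cscalar_prod_sum[of _ n] algebra_simps sum_subtractf sum.distrib)
  have "u \<noteq> 0\<^sub>v n"
  proof
    assume "u = 0\<^sub>v n"
    then have "(x - y) $ i = 0" if "i < n" for i
      using that by (simp add: u_def)
    then have "x $ i = y $ i" if "i < n" for i
      using x y that by auto
    then show False using False x y by (auto intro!: eq_vecI)
  qed
  then have "u \<bullet>c u \<noteq> 0" using u by simp
  \<comment> \<open>If \<open>x \<bullet>c u\<close> vanished, so would its sum with its conjugate,
    which is the squared norm of the nonzero u. Hence a is a genuine reciprocal.\<close>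
  then have nz: "x \<bullet>c u \<noteq> 0" using uu by auto
  define H where "H = mat n n (\<lambda>(i, j). (if i = j then 1 else 0) - a * u $ i * cnj (u $ j))"
  have H: "H \<in> carrier_mat n n" by (auto simp: H_def)
  have Hv: "H *\<^sub>v z = z - (a * (z \<bullet>c u)) \<cdot>\<^sub>v u" if z: "z \<in> carrier_vec n" for z
  proof (rule eq_vecI)
    fix i assume "i < dim_vec (z - (a * (z \<bullet>c u)) \<cdot>\<^sub>v u)"
    then have i: "i < n" using u by auto
    have "(H *\<^sub>v z) $ i = (\<Sum>k<n. ((if i = k then 1 else 0) - a * u $ i * cnj (u $ k)) * z $ k)"
      unfolding index_mult_vec_sum[OF H z i] by (rule sum.cong) (auto simp: H_def i)
    also have "\<dots> = (\<Sum>k<n. if i = k then z $ k else 0) - (\<Sum>k<n. a * u $ i * cnj (u $ k) * z $ k)"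
      unfolding sum_subtractf[symmetric] by (rule sum.cong) (auto simp: algebra_simps)
    also have "\<dots> = z $ i - a * (z \<bullet>c u) * u $ i"
      using i by (auto simp: cscalar_prod_sum[OF u] sum_distrib_left sum_distrib_right mult_ac)
    finally show "(H *\<^sub>v z) $ i = (z - (a * (z \<bullet>c u)) \<cdot>\<^sub>v u) $ i" using i u z by auto
  qed (use H u in auto)
  \<comment> \<open>In the product of the adjoint of H with H, the coefficient of the rank-one part
    is the difference of these two sides.\<close>
  have key: "a + cnj a = a * cnj a * (u \<bullet>c u)"
    unfolding uu using nz by (simp add: a_def field_simps)
  have "mat_adjoint H * H = 1\<^sub>m n"
  proof (rule eq_matI)
    fix i j assume "i < dim_row (1\<^sub>m n :: complex mat)" "j < dim_col (1\<^sub>m n :: complex mat)"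
    then have i: "i < n" and j: "j < n" by auto
    have "(mat_adjoint H * H) $$ (i, j) = (\<Sum>k<n. cnj (H $$ (k, i)) * H $$ (k, j))"
      using H i j by (subst index_mult_mat_sum[of _ n n _ n]) auto
    also have "\<dots> = (\<Sum>k<n. (if k = i then if i = j then 1 else 0 else 0)
        - (if k = i then a * u $ k * cnj (u $ j) else 0)
        - (if k = j then cnj a * cnj (u $ k) * u $ i else 0)
        + a * cnj a * u $ i * cnj (u $ j) * (u $ k * cnj (u $ k)))"
      by (rule sum.cong) (auto simp: H_def i j algebra_simps)
    also have "\<dots> = (if i = j then 1 else 0) - a * u $ i * cnj (u $ j) - cnj a * cnj (u $ j) * u $ i
        + a * cnj a * u $ i * cnj (u $ j) * (u \<bullet>c u)"
      unfolding sum.distrib sum_subtractf sum_distrib_left[symmetric] cscalar_prod_sum[OF u]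
      using i j by simp
    also have "\<dots> = (if i = j then 1 else 0) - u $ i * cnj (u $ j) * (a + cnj a - a * cnj a * (u \<bullet>c u))"
      by (simp add: algebra_simps)
    finally show "(mat_adjoint H * H) $$ (i, j) = 1\<^sub>m n $$ (i, j)" using key i j by auto
  qed (use H in auto)
  then have "unitary_mat n H" by (rule unitary_matI[OF H])
  moreover have "H *\<^sub>v x = y"
    unfolding Hv[OF x(1)] using nz x y by (auto simp: a_def u_def)
  moreover have "H *\<^sub>v z = z" if "z \<in> carrier_vec n" "z \<bullet>c x = 0" "z \<bullet>c y = 0" for z
  proof -
    have "z \<bullet>c u = z \<bullet>c x - z \<bullet>c y"
      using x y by (auto simp: u_def cscalar_prod_sum[of _ n] algebra_simps sum_subtractf)
    then show ?thesis unfolding Hv[OF that(1)] using that u by auto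
  qed
  ultimately show ?thesis by blast
qed

section \<open>Extending orthonormal columns to a unitary\<close>

lemma mult_mat_unit_vec:
  assumes "A \<in> carrier_mat n m" "j < m"
  shows "(A :: complex mat) *\<^sub>v unit_vec m j = col A j"
  using assms by (intro eq_vecI) auto

lemma cscalar_prod_unit_vec:
  fixes v :: "complex vec"
  assumes "v \<in> carrier_vec n" "j < n"
  shows "v \<bullet>c unit_vec n j = v $ j"
  using assms by (subst cscalar_prod_sum[of _ n]) (auto simp: unit_vec_def if_distrib cong: if_cong)

lemma cscalar_prod_conj:
  fixes v w :: "complex vec"
  assumes "v \<in> carrier_vec n" "w \<in> carrier_vec n"
  shows "v \<bullet>c w = cnj (w \<bullet>c v)"
  using assms by (auto simp: cscalar_prod_sum[of _ n] mult.commute)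

lemma isometry_col_cscalar_prod:
  fixes W :: "complex mat"
  assumes "W \<in> carrier_mat n m" "mat_adjoint W * W = 1\<^sub>m m" "i < m" "j < m"
  shows "col W i \<bullet>c col W j = (if i = j then 1 else 0)"
proof -
  have "col W i \<bullet>c col W j = (\<Sum>k<n. cnj (W $$ (k, j)) * W $$ (k, i))"
    using assms by (subst cscalar_prod_sum[of _ n]) (auto simp: mult.commute)
  also have "\<dots> = (mat_adjoint W * W) $$ (j, i)"
    using assms by (subst index_mult_mat_sum[of _ m n _ m]) auto
  finally show ?thesis using assms by auto
qed

text \<open>Induction on the number k of columns already matched. Column k of W is pulled back by U
  to a unit vector w, and a reflection H with H e_k = w is multiplied to U from the right.\<close>

lemma isometry_completion:
  assumes W: "W \<in> carrier_mat n m" "mat_adjoint W * W = 1\<^sub>m m" and "m \<le> n"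
  shows "\<exists>U. unitary_mat n U \<and> (\<forall>j<m. col U j = col W j)"
proof -
  have "\<exists>U. unitary_mat n U \<and> (\<forall>j<k. col U j = col W j)" if "k \<le> m" for k
    using that
  proof (induction k)
    case 0
    then show ?case using unitary_one_mat by auto
  next
    case (Suc k)
    then obtain U where U: "unitary_mat n U" and cols: "\<And>j. j < k \<Longrightarrow> col U j = col W j" by auto
    have Uc: "U \<in> carrier_mat n n" using U by (simp add: unitary_mat_def)
    have k: "k < m" "k < n" using Suc.prems \<open>m \<le> n\<close> by auto
    define w where "w = mat_adjoint U *\<^sub>v col W k"
    have Wk: "col W k \<in> carrier_vec n" using W by auto
    have w: "w \<in> carrier_vec n" using Uc by (auto simp: w_def intro!: mult_mat_vec_carrier[of _ _ n] Wk)
    have "w \<bullet>c w = 1"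
      unfolding w_def unitary_cscalar_prod[OF unitary_adjoint[OF U] Wk Wk]
      using isometry_col_cscalar_prod[OF W k(1) k(1)] by simp
    moreover have "unit_vec n k \<bullet>c unit_vec n k = (1 :: complex)"
      using k by (subst cscalar_prod_unit_vec) auto
    ultimately obtain H where H: "unitary_mat n H" "H *\<^sub>v unit_vec n k = w"
        "\<And>z. z \<in> carrier_vec n \<Longrightarrow> z \<bullet>c unit_vec n k = 0 \<Longrightarrow> z \<bullet>c w = 0 \<Longrightarrow> H *\<^sub>v z = z"
      using complex_householder[of "unit_vec n k" n w] w by auto
    have Hc: "H \<in> carrier_mat n n" using H by (simp add: unitary_mat_def)
    have "col (U * H) j = col W j" if "j < Suc k" for j
    proof -
      have j: "j < n" using that k by auto
      have "col (U * H) j = U *\<^sub>v (H *\<^sub>v unit_vec n j)"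
        using Uc Hc j by (simp flip: mult_mat_unit_vec[of _ n n])
      also have "\<dots> = col W j"
      proof (cases "j = k")
        case True
        then show ?thesis
          using H(2) unitary_mat_adjoint_mult_vec(2)[OF U Wk] by (simp add: w_def)
      next
        case False
        then have jk: "j < k" using that by simp
        have Uj: "U *\<^sub>v unit_vec n j = col W j"
          using mult_mat_unit_vec[OF Uc j] cols[OF jk] by simp
        \<comment> \<open>Earlier unit vectors are orthogonal to e_k and, because the columns of W
          are orthonormal, also to w; the reflection therefore fixes them and the matched columns
          survive.\<close>
        have "unit_vec n j \<bullet>c w = (U *\<^sub>v unit_vec n j) \<bullet>c col W k"
          unfolding w_def using Uc Wk by (intro cscalar_prod_adjoint[symmetric]) auto
        also have "\<dots> = 0"
          unfolding Uj using isometry_col_cscalar_prod[OF W _ k(1), of j] jk k by auto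
        finally have "H *\<^sub>v unit_vec n j = unit_vec n j"
          using j k jk by (intro H(3)) (auto simp: cscalar_prod_unit_vec)
        then show ?thesis using Uj by simp
      qed
      finally show ?thesis .
    qed
    then show ?case using unitary_mat_mult[OF U H(1)] by auto
  qed
  then show ?thesis by auto
qed

section \<open>Diagonalising Hermitian matrices\<close>

lemma normalize_vec:
  fixes w :: "complex vec"
  assumes "w \<in> carrier_vec n" "w \<noteq> 0\<^sub>v n"
  shows "\<exists>c. (c \<cdot>\<^sub>v w) \<bullet>c (c \<cdot>\<^sub>v w) = 1"
proof -
  define s where "s = (\<Sum>k<n. (cmod (w $ k))\<^sup>2)"
  have s: "w \<bullet>c w = of_real s"
    using assms by (simp add: cscalar_prod_sum[of _ n] s_def complex_norm_square[symmetric])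
  have "w \<bullet>c w \<noteq> 0" using assms by simp
  then have "s \<noteq> 0" using s by auto
  moreover have "s \<ge> 0" by (auto simp: s_def intro: sum_nonneg)
  ultimately have "s > 0" by simp
  define c where "c = complex_of_real (1 / sqrt s)"
  have "(c \<cdot>\<^sub>v w) \<bullet>c (c \<cdot>\<^sub>v w) = (c * cnj c) * (w \<bullet>c w)"
    using assms by (auto simp: cscalar_prod_sum[of _ n] sum_distrib_left mult_ac intro!: sum.cong)
  also have "c * cnj c = of_real (1 / s)"
    using \<open>s > 0\<close> by (simp add: c_def flip: of_real_mult)
  finally show ?thesis using s \<open>s > 0\<close> by (intro exI[of _ c]) (simp flip: of_real_mult)
qed

lemma sum_lessThan_add:
  fixes k m :: nat
  shows "(\<Sum>l<k + m. f l) = (\<Sum>l<k. f l) + (\<Sum>l<m. f (k + l) :: 'a :: comm_monoid_add)"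
  by (induction m) (auto simp: add.assoc)

text \<open>
  Once the first \<open>k\<close> columns of \<open>V\<close> are eigenvectors, \<open>V\<^sup>* A V\<close> splits off a diagonal \<open>k \<times> k\<close> block; an
  eigenvector of the complementary block is reflected into position \<open>k\<close>.
\<close>

lemma hermitian_eigenbasis:
  assumes A: "A \<in> carrier_mat n n" "hermitian_mat A"
  shows "\<exists>V. unitary_mat n V \<and> (\<forall>j<n. \<exists>x. A *\<^sub>v col V j = x \<cdot>\<^sub>v col V j)"
proof -
  have "\<exists>V. unitary_mat n V \<and> (\<forall>j<k. \<exists>x. A *\<^sub>v col V j = x \<cdot>\<^sub>v col V j)" if "k \<le> n" for k
    using that
  proof (induction k)
    case 0
    then show ?case using unitary_one_mat by auto
  next
    case (Suc k)
    then obtain V where V: "unitary_mat n V"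
      and cols: "\<And>j. j < k \<Longrightarrow> \<exists>x. A *\<^sub>v col V j = x \<cdot>\<^sub>v col V j" by auto
    have Vc: "V \<in> carrier_mat n n" using V by (simp add: unitary_mat_def)
    \<comment> \<open>B is A in the basis given by the columns of V. Its first k columns are
      diagonal, and Hermiticity carries their zeros over to the first k rows.\<close>
    define B where "B = mat_adjoint V * (A * V)"
    have Bc: "B \<in> carrier_mat n n" using Vc A by (auto simp: B_def intro!: mult_carrier_mat[of _ n n])
    have Bv: "B *\<^sub>v v = mat_adjoint V *\<^sub>v (A *\<^sub>v (V *\<^sub>v v))" if "v \<in> carrier_vec n" for v
      using that Vc A unfolding B_def
      by (simp add: assoc_mult_mat_vec[of _ n n _ n] mult_mat_vec_carrier[of _ n n])
    have B_entry: "B $$ (i, j) = col (A * V) j \<bullet>c col V i" if "i < n" "j < n" for i j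
    proof -
      have "B $$ (i, j) = (\<Sum>k<n. mat_adjoint V $$ (i, k) * (A * V) $$ (k, j))"
        unfolding B_def using that Vc A
        by (intro index_mult_mat_sum[of _ n n _ n]) (auto intro: mult_carrier_mat[of _ n n])
      also have "\<dots> = (\<Sum>k<n. col (A * V) j $ k * cnj (col V i $ k))"
        using that Vc A by (intro sum.cong) auto
      also have "\<dots> = col (A * V) j \<bullet>c col V i"
        using Vc by (intro cscalar_prod_sum[symmetric]) auto
      finally show ?thesis .
    qed
    have AV: "col (A * V) j = A *\<^sub>v col V j" if "j < n" for j
      using A(1) Vc that by (rule col_mult2)
    have B_herm: "B $$ (i, j) = cnj (B $$ (j, i))" if "i < n" "j < n" for i j
    proof -
      have ci: "col V i \<in> carrier_vec n" and cj: "col V j \<in> carrier_vec n" using Vc by auto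
      have "(A *\<^sub>v col V j) \<bullet>c col V i = col V j \<bullet>c (A *\<^sub>v col V i)"
        using cscalar_prod_adjoint[OF A(1) cj ci] A(2) by (simp add: hermitian_mat_def)
      also have "\<dots> = cnj ((A *\<^sub>v col V i) \<bullet>c col V j)"
        using A ci cj by (intro cscalar_prod_conj[of _ n]) (auto intro: mult_mat_vec_carrier)
      finally show ?thesis unfolding B_entry[OF that] B_entry[OF that(2,1)] AV[OF that(1)] AV[OF that(2)] .
    qed
    have B0: "B $$ (i, j) = 0" if ij: "i < n" "j < k" "i \<noteq> j" for i j
    proof -
      have j: "j < n" using ij Suc.prems by simp
      obtain x where x: "A *\<^sub>v col V j = x \<cdot>\<^sub>v col V j" using cols ij by blast
      have "B $$ (i, j) = x * (col V j \<bullet>c col V i)"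
        unfolding B_entry[OF ij(1) j] AV[OF j] x using Vc j by simp
      then show ?thesis
        using isometry_col_cscalar_prod[OF Vc _ j ij(1)] V ij by (simp add: unitary_mat_def)
    qed
    define m where "m = n - k"
    have n: "n = k + m" and "m \<noteq> 0" using Suc.prems by (auto simp: m_def)
    define C where "C = mat m m (\<lambda>(i, j). B $$ (k + i, k + j))"
    have Cc: "C \<in> carrier_mat m m" by (simp add: C_def)
    \<comment> \<open>A complex matrix of positive size has an eigenvalue; the size m is positive
      because k < n.\<close>
    obtain x where "eigenvalue C x"
      using spectrum_non_empty[OF Cc] \<open>m \<noteq> 0\<close> by (auto simp: spectrum_def)
    then obtain u where u: "u \<in> carrier_vec m" "u \<noteq> 0\<^sub>v m" "C *\<^sub>v u = x \<cdot>\<^sub>v u"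
      using Cc by (auto simp: eigenvalue_def eigenvector_def)
    define w where "w = vec n (\<lambda>i. if i < k then 0 else u $ (i - k))"
    have w: "w \<in> carrier_vec n" by (simp add: w_def)
    have "w \<noteq> 0\<^sub>v n"
    proof
      assume "w = 0\<^sub>v n"
      then have "w $ (k + i) = 0" if "i < m" for i using that n by simp
      then have "u $ i = 0" if "i < m" for i using that n by (simp add: w_def)
      then have "u = 0\<^sub>v m" using u(1) by (intro eq_vecI) auto
      then show False using u(2) by simp
    qed
    then obtain c where c: "(c \<cdot>\<^sub>v w) \<bullet>c (c \<cdot>\<^sub>v w) = 1" using normalize_vec[OF w] by blast
    \<comment> \<open>Rows with index below k meet only the vanishing off-diagonal block; the other
      rows reproduce C applied to u.\<close>
    have Bw: "B *\<^sub>v w = x \<cdot>\<^sub>v w"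
    proof (rule eq_vecI)
      fix i assume "i < dim_vec (x \<cdot>\<^sub>v w)"
      then have i: "i < n" by (simp add: w_def)
      have "(B *\<^sub>v w) $ i = (\<Sum>l<m. B $$ (i, k + l) * u $ l)"
        unfolding index_mult_vec_sum[OF Bc w i] unfolding n sum_lessThan_add by (simp add: w_def n)
      also have "\<dots> = x * w $ i"
      proof (cases "i < k")
        case True
        then have "B $$ (i, k + l) = 0" if "l < m" for l
          using B_herm[of i "k + l"] B0[of "k + l" i] that n by simp
        then show ?thesis using True i by (simp add: w_def)
      next
        case False
        define i' where "i' = i - k"
        have i': "i = k + i'" "i' < m" using False i n by (auto simp: i'_def)
        have "(\<Sum>l<m. B $$ (i, k + l) * u $ l) = (C *\<^sub>v u) $ i'"
          unfolding index_mult_vec_sum[OF Cc u(1) i'(2)] using i' by (simp add: C_def)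
        then show ?thesis unfolding u(3) using i' u(1) n by (simp add: w_def)
      qed
      finally show "(B *\<^sub>v w) $ i = (x \<cdot>\<^sub>v w) $ i" using i w by simp
    qed (use Bc w in auto)
    have k: "k < n" using Suc.prems by simp
    define w' where "w' = c \<cdot>\<^sub>v w"
    have w': "w' \<in> carrier_vec n" "w' \<bullet>c w' = 1" using w c by (auto simp: w'_def)
    have Bw': "B *\<^sub>v w' = x \<cdot>\<^sub>v w'"
      unfolding w'_def using mult_mat_vec[OF Bc w] Bw by (simp add: smult_smult_assoc mult.commute)
    have "unit_vec n k \<bullet>c unit_vec n k = (1 :: complex)"
      using k by (subst cscalar_prod_unit_vec) auto
    then obtain H where H: "unitary_mat n H" "H *\<^sub>v unit_vec n k = w'"
        "\<And>z. z \<in> carrier_vec n \<Longrightarrow> z \<bullet>c unit_vec n k = 0 \<Longrightarrow> z \<bullet>c w' = 0 \<Longrightarrow> H *\<^sub>v z = z"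
      using complex_householder[of "unit_vec n k" n w'] w' by auto
    have Hc: "H \<in> carrier_mat n n" using H by (simp add: unitary_mat_def)
    have "\<exists>x. A *\<^sub>v col (V * H) j = x \<cdot>\<^sub>v col (V * H) j" if "j < Suc k" for j
    proof -
      have j: "j < n" using that k by auto
      have col: "col (V * H) j = V *\<^sub>v (H *\<^sub>v unit_vec n j)"
        using Vc Hc j by (simp flip: mult_mat_unit_vec[of _ n n])
      show ?thesis
      proof (cases "j = k")
        case True
        have "A *\<^sub>v (V *\<^sub>v w') = V *\<^sub>v (B *\<^sub>v w')"
          unfolding Bv[OF w'(1)] using A Vc w'
          by (intro unitary_mat_adjoint_mult_vec(2)[OF V, symmetric])
            (auto intro!: mult_mat_vec_carrier[of _ n n])
        also have "\<dots> = x \<cdot>\<^sub>v (V *\<^sub>v w')"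
          unfolding Bw' using mult_mat_vec[OF Vc w'(1)] .
        finally show ?thesis unfolding col unfolding True H(2) by blast
      next
        case False
        then have jk: "j < k" using that by simp
        \<comment> \<open>The first k entries of w' are zero by the padding, so the reflection
          leaves the eigenvectors already found untouched.\<close>
        have "unit_vec n j \<bullet>c w' = cnj (w' \<bullet>c unit_vec n j)"
          using w' by (intro cscalar_prod_conj[of _ n]) auto
        also have "\<dots> = 0"
          using w' j jk by (simp add: cscalar_prod_unit_vec w'_def w_def)
        finally have "H *\<^sub>v unit_vec n j = unit_vec n j"
          using j k jk by (intro H(3)) (auto simp: cscalar_prod_unit_vec)
        then show ?thesis unfolding col using cols[OF jk] mult_mat_unit_vec[OF Vc j] by simp
      qed
    qed
    then show ?case using unitary_mat_mult[OF V H(1)] by auto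
  qed
  then show ?thesis by auto
qed

text \<open>For a unitary eigenbasis V with eigenvalues x_i, let W be the diagonal matrix of the
  roots of a + b x_i times the adjoint of V; the Gram matrix of W is then a + b A in spectral form.
  Testing real eigenvalues is enough, since a Hermitian matrix has no others.\<close>

lemma hermitian_affine_gram:
  assumes A: "A \<in> carrier_mat n n" "hermitian_mat A"
    and nonneg: "\<And>x. eigenvalue A (complex_of_real x) \<Longrightarrow> 0 \<le> a + b * x"
  shows "\<exists>W \<in> carrier_mat n n.
           mat_adjoint W * W = complex_of_real a \<cdot>\<^sub>m 1\<^sub>m n + complex_of_real b \<cdot>\<^sub>m A"
proof -
  obtain V where V: "unitary_mat n V" and cols: "\<And>j. j < n \<Longrightarrow> \<exists>x. A *\<^sub>v col V j = x \<cdot>\<^sub>v col V j"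
    using hermitian_eigenbasis[OF A] by blast
  have Vc: "V \<in> carrier_mat n n" "mat_adjoint V * V = 1\<^sub>m n" "V * mat_adjoint V = 1\<^sub>m n"
    using V by (auto simp: unitary_mat_def)
  \<comment> \<open>Eigenvalues are real: moving A across the inner product of a unit eigenvector
    with itself gives x = cnj x.\<close>
  have "\<exists>x. A *\<^sub>v col V j = complex_of_real x \<cdot>\<^sub>v col V j" if j: "j < n" for j
  proof -
    obtain x where x: "A *\<^sub>v col V j = x \<cdot>\<^sub>v col V j" using cols[OF j] by blast
    have cj: "col V j \<in> carrier_vec n" using Vc by auto
    have "(A *\<^sub>v col V j) \<bullet>c col V j = col V j \<bullet>c (A *\<^sub>v col V j)"
      using cscalar_prod_adjoint[OF A(1) cj cj] A(2) by (simp add: hermitian_mat_def)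
    then have "x = cnj x"
      unfolding x using cj isometry_col_cscalar_prod[OF Vc(1,2) j j] by (simp add: conjugate_smult_vec)
    then have "x = complex_of_real (Re x)" by (simp add: complex_eq_iff)
    then show ?thesis using x by metis
  qed
  then obtain x where x: "\<And>j. j < n \<Longrightarrow> A *\<^sub>v col V j = complex_of_real (x j) \<cdot>\<^sub>v col V j" by metis
  have x_nonneg: "0 \<le> a + b * x j" if j: "j < n" for j
  proof -
    \<comment> \<open>Unit length makes the column nonzero, so \<open>x j\<close> is an eigenvalue
      in the strict sense and the hypothesis on the spectrum applies.\<close>
    have "col V j \<bullet>c col V j = 1" using isometry_col_cscalar_prod[OF Vc(1,2) j j] by simp
    then have "col V j \<noteq> 0\<^sub>v n" by auto
    then have "eigenvector A (col V j) (complex_of_real (x j))"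
      using x[OF j] A Vc j by (auto simp: eigenvector_def)
    then show ?thesis by (intro nonneg) (auto simp: eigenvalue_def)
  qed
  define W where "W = mat n n (\<lambda>(i, j). complex_of_real (sqrt (a + b * x i)) * cnj (V $$ (j, i)))"
  have Wc: "W \<in> carrier_mat n n" by (simp add: W_def)
  have A_entry: "A $$ (p, q) = (\<Sum>i<n. complex_of_real (x i) * V $$ (p, i) * cnj (V $$ (q, i)))"
    if "p < n" "q < n" for p q
  proof -
    have "A = A * V * mat_adjoint V"
      using A Vc assoc_mult_mat[of A n n V n "mat_adjoint V" n] by simp
    then have "A $$ (p, q) = (A * V * mat_adjoint V) $$ (p, q)" by simp
    also have "\<dots> = (\<Sum>i<n. (A * V) $$ (p, i) * cnj (V $$ (q, i)))"
      using A Vc that by (subst index_mult_mat_sum[of _ n n _ n]) auto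
    also have "\<dots> = (\<Sum>i<n. complex_of_real (x i) * V $$ (p, i) * cnj (V $$ (q, i)))"
    proof (rule sum.cong)
      fix i assume "i \<in> {..<n}"
      then have "(A * V) $$ (p, i) = (A *\<^sub>v col V i) $ p" using A Vc that by simp
      also have "\<dots> = complex_of_real (x i) * V $$ (p, i)"
        using \<open>i \<in> {..<n}\<close> Vc that by (subst x) auto
      finally show "(A * V) $$ (p, i) * cnj (V $$ (q, i)) = complex_of_real (x i) * V $$ (p, i) * cnj (V $$ (q, i))"
        by simp
    qed simp
    finally show ?thesis .
  qed
  have one_entry: "(1\<^sub>m n) $$ (p, q) = (\<Sum>i<n. V $$ (p, i) * cnj (V $$ (q, i)))"
    if "p < n" "q < n" for p q
    unfolding Vc(3)[symmetric] using Vc(1) that by (subst index_mult_mat_sum[of _ n n _ n]) auto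
  have "mat_adjoint W * W = complex_of_real a \<cdot>\<^sub>m 1\<^sub>m n + complex_of_real b \<cdot>\<^sub>m A"
  proof (rule eq_matI)
    fix p q
    assume "p < dim_row (complex_of_real a \<cdot>\<^sub>m 1\<^sub>m n + complex_of_real b \<cdot>\<^sub>m A)"
      "q < dim_col (complex_of_real a \<cdot>\<^sub>m 1\<^sub>m n + complex_of_real b \<cdot>\<^sub>m A)"
    then have p: "p < n" and q: "q < n" using A by auto
    have "(mat_adjoint W * W) $$ (p, q) = (\<Sum>i<n. cnj (W $$ (i, p)) * W $$ (i, q))"
      using Wc p q by (subst index_mult_mat_sum[of _ n n _ n]) auto
    also have "\<dots> = (\<Sum>i<n. complex_of_real a * (V $$ (p, i) * cnj (V $$ (q, i)))
        + complex_of_real b * (complex_of_real (x i) * V $$ (p, i) * cnj (V $$ (q, i))))"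
    proof (rule sum.cong)
      fix i assume "i \<in> {..<n}"
      then have i: "i < n" by simp
      have "complex_of_real (sqrt (a + b * x i)) * complex_of_real (sqrt (a + b * x i))
          = complex_of_real a + complex_of_real b * complex_of_real (x i)"
        using x_nonneg[OF i] by (simp flip: of_real_mult of_real_add)
      then have "cnj (W $$ (i, p)) * W $$ (i, q)
          = (complex_of_real a + complex_of_real b * complex_of_real (x i)) * (V $$ (p, i) * cnj (V $$ (q, i)))"
        using i p q by (simp add: W_def mult_ac)
      then show "cnj (W $$ (i, p)) * W $$ (i, q) = complex_of_real a * (V $$ (p, i) * cnj (V $$ (q, i)))
        + complex_of_real b * (complex_of_real (x i) * V $$ (p, i) * cnj (V $$ (q, i)))"
        by (simp add: algebra_simps)
    qed simp
    also have "\<dots> = (complex_of_real a \<cdot>\<^sub>m 1\<^sub>m n + complex_of_real b \<cdot>\<^sub>m A) $$ (p, q)"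
      using A(1) p q unfolding sum.distrib sum_distrib_left[symmetric] A_entry[OF p q, symmetric]
        one_entry[OF p q, symmetric] by simp
    finally show "(mat_adjoint W * W) $$ (p, q)
        = (complex_of_real a \<cdot>\<^sub>m 1\<^sub>m n + complex_of_real b \<cdot>\<^sub>m A) $$ (p, q)" .
  qed (use A Wc in auto)
  then show ?thesis using Wc by blast
qed

text \<open>\<open>Max\<close> bounds its elements only on finite sets; this makes
  \<open>largest_eigenvalue\<close> and the shift constant of the splitting actual bounds.\<close>

lemma finite_real_eigenvalues:
  assumes "A \<in> carrier_mat n n"
  shows "finite {x. eigenvalue A (complex_of_real x)}"
proof -
  have "finite (complex_of_real -` spectrum A)"
    using card_finite_spectrum(1)[OF assms] by (rule finite_vimageI) (simp add: inj_on_def)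
  then show ?thesis by (simp add: spectrum_def vimage_def)
qed

section \<open>Block matrices, trace and positivity\<close>

lemma sum_mats_carrier [simp]: "sum_mats n m F \<in> carrier_mat n n"
  by (simp add: sum_mats_def)

lemma sum_mats_dim [simp]: "dim_row (sum_mats n m F) = n" "dim_col (sum_mats n m F) = n"
  by (simp_all add: sum_mats_def)

lemma index_sum_mats: "i < n \<Longrightarrow> j < n \<Longrightarrow> sum_mats n m F $$ (i, j) = (\<Sum>k<m. F k $$ (i, j))"
  by (simp add: sum_mats_def)

lemma mat_block_carrier [simp]: "mat_block d X i j \<in> carrier_mat d d"
  by (simp add: mat_block_def)

lemma mat_block_dim [simp]: "dim_row (mat_block d X i j) = d" "dim_col (mat_block d X i j) = d"
  by (simp_all add: mat_block_def)

lemma index_mat_block: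
  "a < d \<Longrightarrow> b < d \<Longrightarrow> mat_block d X i j $$ (a, b) = X $$ (i * d + a, j * d + b)"
  by (simp add: mat_block_def)

lemma partial_trace_carrier [simp]: "partial_trace n d X \<in> carrier_mat d d"
  by (simp add: partial_trace_def)

text \<open>The index \<open>i * d + a\<close> of the product basis takes each value below
  \<open>n * d\<close> exactly once; sums over the tensor product are regrouped into blocks this way
  throughout.\<close>

lemma sum_blocks:
  fixes f :: "nat \<Rightarrow> 'a :: comm_monoid_add"
  shows "(\<Sum>k<n * d. f k) = (\<Sum>i<n. \<Sum>a<d. f (i * d + a))"
  by (induction n) (auto simp: sum_lessThan_add add.commute[of d])

lemma block_index_less:
  fixes i a n d :: nat
  assumes "i < n" "a < d"
  shows "i * d + a < n * d"
proof -
  have "i * d + a < (i + 1) * d" using assms by simp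
  also have "\<dots> \<le> n * d" using assms by (intro mult_le_mono1) simp
  finally show ?thesis .
qed

lemma triple_product_entry:
  assumes "A \<in> carrier_mat n m" "B \<in> carrier_mat m p" "C \<in> carrier_mat p q" "i < n" "j < q"
  shows "(A * B * C :: complex mat) $$ (i, j) = (\<Sum>k<m. \<Sum>l<p. A $$ (i, k) * B $$ (k, l) * C $$ (l, j))"
proof -
  have "A * B \<in> carrier_mat n p" using assms by simp
  then have "(A * B * C) $$ (i, j) = (\<Sum>l<p. (A * B) $$ (i, l) * C $$ (l, j))"
    using assms by (intro index_mult_mat_sum)
  also have "\<dots> = (\<Sum>l<p. \<Sum>k<m. A $$ (i, k) * B $$ (k, l) * C $$ (l, j))"
    using assms by (intro sum.cong)
      (auto simp: index_mult_mat_sum[of A n m B p] sum_distrib_right simp del: index_mult_mat(1))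
  finally show ?thesis by (subst sum.swap)
qed

lemma conjugation_entry:
  fixes K :: "complex mat"
  assumes "K \<in> carrier_mat n m" "X \<in> carrier_mat m m" "i < n" "j < n"
  shows "(K * X * mat_adjoint K) $$ (i, j) = (\<Sum>k<m. \<Sum>l<m. K $$ (i, k) * X $$ (k, l) * cnj (K $$ (j, l)))"
  using assms by (subst triple_product_entry[of _ n m _ m _ n]) (auto intro!: sum.cong)

section \<open>Trace and partial trace\<close>

lemma mat_trace_sum: "A \<in> carrier_mat n n \<Longrightarrow> mat_trace A = (\<Sum>i<n. A $$ (i, i))"
  by (auto simp: mat_trace_def)

lemma mat_trace_mult_comm:
  assumes "A \<in> carrier_mat n m" "B \<in> carrier_mat m n"
  shows "mat_trace (A * B) = mat_trace (B * A)"
proof -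
  have "mat_trace (A * B) = (\<Sum>i<n. \<Sum>k<m. A $$ (i, k) * B $$ (k, i))"
    using assms by (subst mat_trace_sum[of _ n])
      (auto simp: index_mult_mat_sum[OF assms] intro!: mult_carrier_mat[of _ n m] simp del: index_mult_mat(1))
  also have "\<dots> = (\<Sum>k<m. \<Sum>i<n. B $$ (k, i) * A $$ (i, k))"
    by (subst sum.swap) (simp add: mult.commute)
  also have "\<dots> = mat_trace (B * A)"
    using assms by (subst mat_trace_sum[of _ m])
      (auto simp: index_mult_mat_sum[OF assms(2,1)] intro!: mult_carrier_mat[of _ m n] simp del: index_mult_mat(1))
  finally show ?thesis .
qed

lemma mat_trace_add:
  assumes "A \<in> carrier_mat n n" "B \<in> carrier_mat n n"
  shows "mat_trace (A + B) = mat_trace A + mat_trace B"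
  using assms by (auto simp: mat_trace_def sum.distrib)

lemma mat_trace_minus:
  assumes "A \<in> carrier_mat n n" "B \<in> carrier_mat n n"
  shows "mat_trace (A - B) = mat_trace A - mat_trace B"
  using assms by (auto simp: mat_trace_def sum_subtractf)

lemma mat_trace_smult:
  assumes "A \<in> carrier_mat n n"
  shows "mat_trace (c \<cdot>\<^sub>m A) = c * mat_trace A"
  using assms by (auto simp: mat_trace_def sum_distrib_left)

lemma mat_trace_sum_mats:
  assumes "\<And>k. k < m \<Longrightarrow> F k \<in> carrier_mat n n"
  shows "mat_trace (sum_mats n m F) = (\<Sum>k<m. mat_trace (F k))"
proof -
  have "mat_trace (sum_mats n m F) = (\<Sum>i<n. \<Sum>k<m. F k $$ (i, i))"
    by (simp add: mat_trace_def index_sum_mats)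
  also have "\<dots> = (\<Sum>k<m. \<Sum>i<n. F k $$ (i, i))" by (rule sum.swap)
  also have "\<dots> = (\<Sum>k<m. mat_trace (F k))"
    by (intro sum.cong refl mat_trace_sum[symmetric] assms) simp
  finally show ?thesis .
qed

lemma mat_trace_conjugation:
  assumes "K \<in> carrier_mat n n" "X \<in> carrier_mat n n"
  shows "mat_trace (K * X * mat_adjoint K) = mat_trace (mat_adjoint K * K * X)"
proof -
  have "mat_trace (K * X * mat_adjoint K) = mat_trace (mat_adjoint K * (K * X))"
    using assms by (intro mat_trace_mult_comm[of _ n n]) (auto intro: mult_carrier_mat[of _ n n])
  also have "mat_adjoint K * (K * X) = mat_adjoint K * K * X"
    using assms by (intro assoc_mult_mat[symmetric]) auto
  finally show ?thesis .
qed

lemma mat_trace_partial_trace: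
  assumes "X \<in> carrier_mat (n * d) (n * d)"
  shows "mat_trace (partial_trace n d X) = mat_trace X"
  using assms unfolding partial_trace_def
  by (subst mat_trace_sum_mats) (simp_all add: mat_trace_def sum_blocks index_mat_block)

section \<open>Positive semidefinite matrices\<close>

lemma quadratic_form_sum:
  fixes A :: "complex mat"
  assumes "A \<in> carrier_mat n n" "v \<in> carrier_vec n"
  shows "(A *\<^sub>v v) \<bullet>c v = (\<Sum>i<n. \<Sum>j<n. A $$ (i, j) * v $ j * cnj (v $ i))"
  using assms by (auto simp: cscalar_prod_sum[of _ n] index_mult_vec_sum[of _ n n] sum_distrib_right
      simp del: index_mult_mat_vec)

lemma mat_trace_nonneg:
  assumes "positive_mat n A"
  shows "0 \<le> mat_trace A"
proof -
  have A: "A \<in> carrier_mat n n" using assms by (simp add: positive_mat_def)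
  have "0 \<le> A $$ (i, i)" if i: "i < n" for i
  proof -
    have "0 \<le> (A *\<^sub>v unit_vec n i) \<bullet>c unit_vec n i" using assms by (auto simp: positive_mat_def)
    also have "\<dots> = A $$ (i, i)" using A i by (subst cscalar_prod_unit_vec) auto
    finally show ?thesis .
  qed
  then show ?thesis using A by (auto simp: mat_trace_sum intro!: sum_nonneg)
qed

text \<open>Moving K across the inner product turns the quadratic form at v into that of X at
  \<open>mat_adjoint K *\<^sub>v v\<close>. K may be rectangular.\<close>

lemma positive_mat_conjugation:
  assumes "positive_mat m X" "K \<in> carrier_mat n m"
  shows "positive_mat n (K * X * mat_adjoint K)"
proof -
  have X: "X \<in> carrier_mat m m" using assms by (simp add: positive_mat_def)
  have "0 \<le> (K * X * mat_adjoint K *\<^sub>v v) \<bullet>c v" if v: "v \<in> carrier_vec n" for v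
  proof -
    define w where "w = mat_adjoint K *\<^sub>v v"
    have w: "w \<in> carrier_vec m"
      using assms v by (auto simp: w_def intro!: mult_mat_vec_carrier[of _ m n])
    have "K * X * mat_adjoint K *\<^sub>v v = K *\<^sub>v (X *\<^sub>v w)"
      using assms X v w unfolding w_def
      by (simp add: assoc_mult_mat_vec[of "K * X" n m _ n] assoc_mult_mat_vec[of K n m X m])
    then have "(K * X * mat_adjoint K *\<^sub>v v) \<bullet>c v = (X *\<^sub>v w) \<bullet>c w"
      using assms X v w cscalar_prod_adjoint[of K n m "X *\<^sub>v w" v]
      by (auto simp: w_def intro!: mult_mat_vec_carrier[of _ m m])
    then show ?thesis using assms w by (simp add: positive_mat_def)
  qed
  then show ?thesis using assms X by (auto simp: positive_mat_def intro!: mult_carrier_mat[of _ n m])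
qed

lemma positive_mat_sum_mats:
  assumes "\<And>k. k < m \<Longrightarrow> positive_mat n (F k)"
  shows "positive_mat n (sum_mats n m F)"
proof -
  have F: "F k \<in> carrier_mat n n" if "k < m" for k using assms[OF that] by (simp add: positive_mat_def)
  have "0 \<le> (sum_mats n m F *\<^sub>v v) \<bullet>c v" if v: "v \<in> carrier_vec n" for v
  proof -
    have "(sum_mats n m F *\<^sub>v v) \<bullet>c v = (\<Sum>i<n. \<Sum>j<n. \<Sum>k<m. F k $$ (i, j) * v $ j * cnj (v $ i))"
      using v by (simp add: quadratic_form_sum[of _ n] index_sum_mats sum_distrib_right)
    also have "\<dots> = (\<Sum>i<n. \<Sum>k<m. \<Sum>j<n. F k $$ (i, j) * v $ j * cnj (v $ i))"
      by (intro sum.cong refl sum.swap)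
    also have "\<dots> = (\<Sum>k<m. \<Sum>i<n. \<Sum>j<n. F k $$ (i, j) * v $ j * cnj (v $ i))"
      by (rule sum.swap)
    also have "\<dots> = (\<Sum>k<m. (F k *\<^sub>v v) \<bullet>c v)"
      using F v by (intro sum.cong) (auto simp: quadratic_form_sum[of _ n])
    also have "\<dots> \<ge> 0" using assms v by (intro sum_nonneg) (auto simp: positive_mat_def)
    finally show ?thesis .
  qed
  then show ?thesis by (simp add: positive_mat_def)
qed

lemma positive_mat_smult:
  assumes "positive_mat n A" "0 \<le> c"
  shows "positive_mat n (c \<cdot>\<^sub>m A)"
proof -
  have A: "A \<in> carrier_mat n n" using assms by (simp add: positive_mat_def)
  have "(c \<cdot>\<^sub>m A *\<^sub>v v) \<bullet>c v = c * ((A *\<^sub>v v) \<bullet>c v)" if "v \<in> carrier_vec n" for v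
    using A that by (simp add: quadratic_form_sum[of _ n] sum_distrib_left mult_ac)
  then show ?thesis using assms A by (auto simp: positive_mat_def)
qed

section \<open>The outcome of the measurement\<close>

text \<open>At the diagonal position k only the summand j = k div d contributes, and k div d < r
  amounts to k < r * d: the projector keeps the first r blocks.\<close>

lemma index_outcome_projector:
  assumes "k < (r + 1) * d" "l < (r + 1) * d"
  shows "outcome_projector d r $$ (k, l) = (if k = l \<and> k < r * d then 1 else 0)"
proof -
  have d: "d > 0" using assms by (cases d) auto
  have kl: "k div d < r + 1" "l div d < r + 1"
    using assms by (simp_all only: less_mult_imp_div_less)
  have eq: "k = l \<longleftrightarrow> k div d = l div d \<and> k mod d = l mod d"
    by (metis div_mult_mod_eq)
  have "(ket_bra (r + 1) j j \<otimes>\<^sub>m 1\<^sub>m d) $$ (k, l) = (if j = k div d then if k = l then 1 else 0 else 0)" for j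
  proof -
    have "(ket_bra (r + 1) j j \<otimes>\<^sub>m 1\<^sub>m d) $$ (k, l)
        = (if k div d = j \<and> l div d = j then 1 else 0) * (if k mod d = l mod d then 1 else 0)"
      using assms kl d by (simp add: tensor_mat_def ket_bra_def)
    then show ?thesis using eq by (cases "k = l") auto
  qed
  then have "outcome_projector d r $$ (k, l)
      = (\<Sum>j<r. if j = k div d then if k = l then 1 else 0 else 0)"
    using assms by (simp add: outcome_projector_def index_sum_mats)
  also have "\<dots> = (if k = l \<and> k div d < r then 1 else 0)" by simp
  also have "k div d < r \<longleftrightarrow> k < r * d" using d by (simp add: div_less_iff_less_mult)
  finally show ?thesis .
qed

lemma diagonal_sandwich_entry:
  fixes P X :: "complex mat"
  assumes P: "P \<in> carrier_mat n n" and X: "X \<in> carrier_mat n n" and k: "k < n" and l: "l < n"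
    and diag: "\<And>p q. p < n \<Longrightarrow> q < n \<Longrightarrow> P $$ (p, q) = (if p = q then f p else 0)"
  shows "(P * X * P) $$ (k, l) = f k * X $$ (k, l) * f l"
proof -
  have "(P * X * P) $$ (k, l) = (\<Sum>p<n. \<Sum>q<n. P $$ (k, p) * X $$ (p, q) * P $$ (q, l))"
    by (rule triple_product_entry[OF P X P k l])
  also have "\<dots> = (\<Sum>p<n. P $$ (k, p) * X $$ (p, l) * f l)"
  proof (rule sum.cong[OF refl])
    fix p
    have "(\<Sum>q<n. P $$ (k, p) * X $$ (p, q) * P $$ (q, l))
        = (\<Sum>q<n. if q = l then P $$ (k, p) * X $$ (p, l) * f l else 0)"
      by (rule sum.cong) (auto simp: diag l)
    then show "(\<Sum>q<n. P $$ (k, p) * X $$ (p, q) * P $$ (q, l)) = P $$ (k, p) * X $$ (p, l) * f l"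
      using l by simp
  qed
  also have "\<dots> = (\<Sum>p<n. if p = k then f k * X $$ (k, l) * f l else 0)"
    by (rule sum.cong) (auto simp: diag k)
  finally show ?thesis using k by simp
qed

text \<open>The initial operator occupies only the upper left d x d corner, so just the first d
  columns of U enter; the projector erases all rows and columns from r * d on.\<close>

lemma outcome_operator_entry:
  assumes U: "U \<in> carrier_mat ((r + 1) * d) ((r + 1) * d)" and \<rho>: "\<rho> \<in> carrier_mat d d"
    and kl: "k < (r + 1) * d" "l < (r + 1) * d"
  shows "outcome_operator d r U \<rho> $$ (k, l) = (if k < r * d \<and> l < r * d
           then \<Sum>p<d. \<Sum>q<d. U $$ (k, p) * \<rho> $$ (p, q) * cnj (U $$ (l, q)) else 0)"
proof -
  define N where "N = (r + 1) * d"
  define P where "P = outcome_projector d r"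
  define R where "R = ket_bra (r + 1) 0 0 \<otimes>\<^sub>m \<rho>"
  define X where "X = U * R * mat_adjoint U"
  have P: "P \<in> carrier_mat N N" by (simp add: P_def N_def outcome_projector_def)
  have R: "R \<in> carrier_mat N N" using \<rho> by (simp add: R_def N_def tensor_mat_def ket_bra_def)
  have U': "U \<in> carrier_mat N N" using U by (simp add: N_def)
  have X: "X \<in> carrier_mat N N" using U' R by (auto simp: X_def intro!: mult_carrier_mat[of _ N N])
  have kl': "k < N" "l < N" using kl by (simp_all add: N_def)
  have d: "d > 0" using kl by (cases d) auto
  have R_entry: "R $$ (p, q) = (if p < d \<and> q < d then \<rho> $$ (p, q) else 0)" if "p < N" "q < N" for p q
  proof -
    have "p div d < r + 1" "q div d < r + 1"
      using that by (simp_all only: N_def less_mult_imp_div_less)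
    then show ?thesis
      using that \<rho> d by (simp add: R_def tensor_mat_def ket_bra_def N_def div_eq_0_iff)
  qed
  have restrict: "(\<Sum>p<N. if p < d then f p else 0) = (\<Sum>p<d. f p)" for f :: "nat \<Rightarrow> complex"
    by (rule sum.mono_neutral_cong_right) (auto simp: N_def)
  have X_entry: "X $$ (k, l) = (\<Sum>p<d. \<Sum>q<d. U $$ (k, p) * \<rho> $$ (p, q) * cnj (U $$ (l, q)))"
  proof -
    have "X $$ (k, l) = (\<Sum>p<N. \<Sum>q<N. U $$ (k, p) * R $$ (p, q) * cnj (U $$ (l, q)))"
      unfolding X_def by (rule conjugation_entry[OF U' R kl'])
    also have "\<dots> = (\<Sum>p<N. if p < d then \<Sum>q<N. if q < d
        then U $$ (k, p) * \<rho> $$ (p, q) * cnj (U $$ (l, q)) else 0 else 0)"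
    proof -
      have "U $$ (k, p) * R $$ (p, q) * cnj (U $$ (l, q)) = (if p < d then if q < d then
        U $$ (k, p) * \<rho> $$ (p, q) * cnj (U $$ (l, q)) else 0 else 0)" if "p < N" "q < N" for p q
        using that by (simp add: R_entry)
      then have "(\<Sum>q<N. U $$ (k, p) * R $$ (p, q) * cnj (U $$ (l, q))) = (if p < d then \<Sum>q<N. if q < d then
        U $$ (k, p) * \<rho> $$ (p, q) * cnj (U $$ (l, q)) else 0 else 0)" if "p < N" for p
        using that by simp
      then show ?thesis by (intro sum.cong) auto
    qed
    also have "\<dots> = (\<Sum>p<d. \<Sum>q<d. U $$ (k, p) * \<rho> $$ (p, q) * cnj (U $$ (l, q)))"
      unfolding restrict ..
    finally show ?thesis .
  qed
  have PXP: "outcome_operator d r U \<rho> = P * X * P"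
  proof -
    have UR: "U * R \<in> carrier_mat N N" using U' R by simp
    have "P * U * R * mat_adjoint U = P * X"
      unfolding X_def assoc_mult_mat[OF P U' R]
      by (rule assoc_mult_mat[OF P UR carrier_mat_adjoint[OF U']])
    then show ?thesis unfolding outcome_operator_def P_def[symmetric] R_def[symmetric] by (rule arg_cong)
  qed
  have "outcome_operator d r U \<rho> $$ (k, l)
      = (if k < r * d then 1 else 0) * X $$ (k, l) * (if l < r * d then 1 else 0)"
    unfolding PXP using P X kl' by (rule diagonal_sandwich_entry) (simp add: P_def N_def index_outcome_projector)
  also have "\<dots> = (if k < r * d \<and> l < r * d then X $$ (k, l) else 0)" by simp
  finally show ?thesis unfolding X_entry .
qed

lemma outcome_operator_carrier:
  "outcome_operator d r U \<rho> \<in> carrier_mat ((r + 1) * d) ((r + 1) * d)"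
  by (rule carrier_matI)
    (simp_all only: outcome_operator_def outcome_projector_def index_mult_mat(2,3) sum_mats_dim)

text \<open>This is where the Kraus form appears: the i-th diagonal block of the evolved state is
  the conjugation of \<rho> by the block (i, 0) of U, and the partial trace adds these blocks up,
  with block r removed by the projector.\<close>

lemma partial_trace_outcome_operator:
  assumes U: "U \<in> carrier_mat ((r + 1) * d) ((r + 1) * d)" and \<rho>: "\<rho> \<in> carrier_mat d d"
  shows "partial_trace (r + 1) d (outcome_operator d r U \<rho>)
    = sum_mats d r (\<lambda>i. mat_block d U i 0 * \<rho> * mat_adjoint (mat_block d U i 0))"
proof (rule eq_matI)
  fix a b
  let ?S = "sum_mats d r (\<lambda>i. mat_block d U i 0 * \<rho> * mat_adjoint (mat_block d U i 0))"
  assume "a < dim_row ?S" "b < dim_col ?S"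
  then have a: "a < d" and b: "b < d" by auto
  have less: "i * d + c < (r + 1) * d" "i < r \<Longrightarrow> i * d + c < r * d" if "i < r + 1" "c < d" for i c
    using block_index_less[of i "r + 1" c d] block_index_less[of i r c d] that by auto
  have "partial_trace (r + 1) d (outcome_operator d r U \<rho>) $$ (a, b)
      = (\<Sum>i<r + 1. outcome_operator d r U \<rho> $$ (i * d + a, i * d + b))"
    using a b by (simp add: partial_trace_def index_sum_mats index_mat_block)
  also have "\<dots> = (\<Sum>i<r + 1. if i * d + a < r * d \<and> i * d + b < r * d
      then \<Sum>p<d. \<Sum>q<d. U $$ (i * d + a, p) * \<rho> $$ (p, q) * cnj (U $$ (i * d + b, q)) else 0)"
    using a b less by (intro sum.cong refl outcome_operator_entry[OF U \<rho>]) auto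
  \<comment> \<open>The summand i = r drops out, as r * d + a is never below r * d.\<close>
  also have "\<dots> = (\<Sum>i<r. \<Sum>p<d. \<Sum>q<d. U $$ (i * d + a, p) * \<rho> $$ (p, q) * cnj (U $$ (i * d + b, q)))"
    using a b less by simp
  also have "\<dots> = (\<Sum>i<r. (mat_block d U i 0 * \<rho> * mat_adjoint (mat_block d U i 0)) $$ (a, b))"
    using a b \<rho> by (intro sum.cong refl, subst conjugation_entry[of _ d d]) (auto simp: index_mat_block)
  also have "\<dots> = ?S $$ (a, b)" using a b by (simp add: index_sum_mats)
  finally show "partial_trace (r + 1) d (outcome_operator d r U \<rho>) $$ (a, b) = ?S $$ (a, b)" .
qed (simp_all add: partial_trace_def)

section \<open>Existence of the dilation\<close>

lemma kraus_gram_entry: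
  assumes "\<And>i. i < r \<Longrightarrow> K i \<in> carrier_mat d d" "p < d" "q < d"
  shows "kraus_gram d r K $$ (p, q) = (\<Sum>i<r. \<Sum>a<d. cnj (K i $$ (a, p)) * K i $$ (a, q))"
proof -
  have "(mat_adjoint (K i) * K i) $$ (p, q) = (\<Sum>a<d. cnj (K i $$ (a, p)) * K i $$ (a, q))" if "i < r" for i
    using assms(1)[OF that] assms(2,3) by (subst index_mult_mat_sum[of _ d d _ d]) auto
  then show ?thesis using assms by (simp add: kraus_gram_def index_sum_mats)
qed

lemma kraus_gram_hermitian:
  assumes "\<And>i. i < r \<Longrightarrow> K i \<in> carrier_mat d d"
  shows "hermitian_mat (kraus_gram d r K)"
  unfolding hermitian_mat_def
proof (rule eq_matI)
  fix p q assume "p < dim_row (kraus_gram d r K)" "q < dim_col (kraus_gram d r K)"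
  then have pq: "p < d" "q < d" by (simp_all add: kraus_gram_def)
  then have "mat_adjoint (kraus_gram d r K) $$ (p, q) = cnj (kraus_gram d r K $$ (q, p))"
    by (simp add: kraus_gram_def)
  also have "\<dots> = kraus_gram d r K $$ (p, q)"
    by (simp add: kraus_gram_entry[OF assms pq] kraus_gram_entry[OF assms pq(2,1)] mult.commute)
  finally show "mat_adjoint (kraus_gram d r K) $$ (p, q) = kraus_gram d r K $$ (p, q)" .
qed (simp_all add: kraus_gram_def)

lemma kraus_scale_bounds:
  shows "1 \<le> kraus_scale d r K" "largest_eigenvalue (kraus_gram d r K) \<le> kraus_scale d r K"
  by (auto simp: kraus_scale_def Let_def)

lemma kraus_dilation_exists:
  assumes K: "\<And>i. i < r \<Longrightarrow> K i \<in> carrier_mat d d"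
  shows "\<exists>Kinf U. kraus_dilation d r K Kinf U"
proof -
  define c where "c = kraus_scale d r K"
  define G where "G = kraus_gram d r K"
  have c: "1 \<le> c" "largest_eigenvalue G \<le> c"
    using kraus_scale_bounds by (simp_all add: c_def G_def)
  have G: "G \<in> carrier_mat d d" "hermitian_mat G"
    using kraus_gram_hermitian[OF K] by (simp_all add: G_def kraus_gram_def)
  \<comment> \<open>The choice of c enters here: x is at most the largest eigenvalue of G, hence at
    most c, and dividing by c is safe because c \<ge> 1.\<close>
  have "0 \<le> 1 + (- 1 / c) * x" if "eigenvalue G (complex_of_real x)" for x
  proof -
    have "x \<le> largest_eigenvalue G"
      unfolding largest_eigenvalue_def using that by (intro Max_ge finite_real_eigenvalues[OF G(1)]) simp
    then show ?thesis using c by (simp add: field_simps)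
  qed
  then obtain Kinf where Kinf: "Kinf \<in> carrier_mat d d"
    and gram: "mat_adjoint Kinf * Kinf
      = complex_of_real 1 \<cdot>\<^sub>m 1\<^sub>m d + complex_of_real (- 1 / c) \<cdot>\<^sub>m G"
    using hermitian_affine_gram[OF G, of 1 "- 1 / c"] by blast
  have complete: "complex_of_real (1 / c) \<cdot>\<^sub>m G + mat_adjoint Kinf * Kinf = 1\<^sub>m d"
    unfolding gram using G by (intro eq_matI) auto
  \<comment> \<open>The blocks of the prospective first block column; index r, just past the Kraus
    operators, receives \<open>Kinf\<close>.\<close>
  define B where "B = (\<lambda>i. if i < r then complex_of_real (1 / sqrt c) \<cdot>\<^sub>m K i else Kinf)"
  define S where "S = mat ((r + 1) * d) d (\<lambda>(k, b). B (k div d) $$ (k mod d, b))"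
  have S: "S \<in> carrier_mat ((r + 1) * d) d" by (simp add: S_def)
  have S_entry: "S $$ (i * d + a, b) = B i $$ (a, b)" if "i < r + 1" "a < d" "b < d" for i a b
    using block_index_less[OF that(1,2)] that by (simp add: S_def)
  \<comment> \<open>Summing over blocks gives G / c plus the Gram matrix of \<open>Kinf\<close>, so
    the isometry property is the completeness relation.\<close>
  have "mat_adjoint S * S = 1\<^sub>m d"
  proof (rule eq_matI)
    fix p q assume "p < dim_row (1\<^sub>m d :: complex mat)" "q < dim_col (1\<^sub>m d :: complex mat)"
    then have pq: "p < d" "q < d" by simp_all
    have scale: "cnj (B i $$ (a, p)) * B i $$ (a, q)
        = complex_of_real (1 / c) * (cnj (K i $$ (a, p)) * K i $$ (a, q))" if "i < r" "a < d" for i a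
    proof -
      have "cnj (B i $$ (a, p)) * B i $$ (a, q) = (complex_of_real (1 / sqrt c) * complex_of_real (1 / sqrt c))
          * (cnj (K i $$ (a, p)) * K i $$ (a, q))"
        using K[OF that(1)] that pq by (simp add: B_def)
      also have "complex_of_real (1 / sqrt c) * complex_of_real (1 / sqrt c) = complex_of_real (1 / c)"
        using c by (simp flip: of_real_mult)
      finally show ?thesis .
    qed
    have G_entry: "G $$ (p, q) = (\<Sum>i<r. \<Sum>a<d. cnj (K i $$ (a, p)) * K i $$ (a, q))"
      unfolding G_def using K pq by (rule kraus_gram_entry)
    have "(mat_adjoint S * S) $$ (p, q) = (\<Sum>k<(r + 1) * d. cnj (S $$ (k, p)) * S $$ (k, q))"
      using S pq by (subst index_mult_mat_sum[of _ d "(r + 1) * d" _ d]) auto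
    also have "\<dots> = (\<Sum>i<r + 1. \<Sum>a<d. cnj (B i $$ (a, p)) * B i $$ (a, q))"
      unfolding sum_blocks using pq by (intro sum.cong refl) (simp add: S_entry)
    also have "\<dots> = (\<Sum>i<r. \<Sum>a<d. cnj (B i $$ (a, p)) * B i $$ (a, q))
        + (\<Sum>a<d. cnj (B r $$ (a, p)) * B r $$ (a, q))" by simp
    also have "(\<Sum>i<r. \<Sum>a<d. cnj (B i $$ (a, p)) * B i $$ (a, q)) = complex_of_real (1 / c) * G $$ (p, q)"
      unfolding G_entry sum_distrib_left by (intro sum.cong refl scale) auto
    also have "(\<Sum>a<d. cnj (B r $$ (a, p)) * B r $$ (a, q)) = (mat_adjoint Kinf * Kinf) $$ (p, q)"
      using Kinf pq by (subst index_mult_mat_sum[of _ d d _ d]) (auto simp: B_def)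
    also have "complex_of_real (1 / c) * G $$ (p, q) + (mat_adjoint Kinf * Kinf) $$ (p, q)
        = (complex_of_real (1 / c) \<cdot>\<^sub>m G + mat_adjoint Kinf * Kinf) $$ (p, q)"
      using G Kinf pq by simp
    finally show "(mat_adjoint S * S) $$ (p, q) = 1\<^sub>m d $$ (p, q)" unfolding complete .
  qed (use S in auto)
  \<comment> \<open>Block column 0 of U consists of its first d columns, which are exactly those
    prescribed by S.\<close>
  then obtain U where U: "unitary_mat ((r + 1) * d) U" and cols: "\<And>j. j < d \<Longrightarrow> col U j = col S j"
    using isometry_completion[OF S] by auto
  have Uc: "U \<in> carrier_mat ((r + 1) * d) ((r + 1) * d)" using U by (simp add: unitary_mat_def)
  have B_carrier: "B i \<in> carrier_mat d d" if "i < r + 1" for i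
    using K Kinf by (auto simp: B_def)
  have block: "mat_block d U i 0 = B i" if i: "i < r + 1" for i
  proof (rule eq_matI)
    fix a b assume "a < dim_row (B i)" "b < dim_col (B i)"
    then have ab: "a < d" "b < d" using B_carrier[OF i] by auto
    have less: "i * d + a < (r + 1) * d" "b < (r + 1) * d"
      using block_index_less[OF i ab(1)] ab by auto
    have "mat_block d U i 0 $$ (a, b) = col U b $ (i * d + a)"
      using ab less Uc by (simp add: index_mat_block)
    also have "\<dots> = S $$ (i * d + a, b)" unfolding cols[OF ab(2)] using ab less S by simp
    finally show "mat_block d U i 0 $$ (a, b) = B i $$ (a, b)" using S_entry[OF i ab] by simp
  qed (use B_carrier[OF i] in auto)
  have "kraus_dilation d r K Kinf U"
    unfolding kraus_dilation_def Let_def c_def[symmetric] G_def[symmetric]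
    using Kinf complete U block by (simp add: B_def)
  then show ?thesis by blast
qed

section \<open>Consequences of a given dilation\<close>

lemma kraus_dilation_reproduces:
  assumes K: "kraus_operators d \<Phi> r K" and dil: "kraus_dilation d r K Kinf U" and \<rho>: "\<rho> \<in> carrier_mat d d"
  shows "\<Phi> \<rho> = complex_of_real (kraus_scale d r K) \<cdot>\<^sub>m partial_trace (r + 1) d (outcome_operator d r U \<rho>)"
proof -
  define c where "c = kraus_scale d r K"
  define s where "s = complex_of_real (1 / sqrt c)"
  have "c > 0" using kraus_scale_bounds(1)[of d r K] by (simp add: c_def)
  \<comment> \<open>The block and its adjoint each carry a factor 1 / sqrt c; the prefactor c
    cancels their product.\<close>
  then have cs: "complex_of_real c * (s * s) = 1" by (simp add: s_def flip: of_real_mult)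
  have s_real: "cnj s = s" by (simp add: s_def)
  have U: "U \<in> carrier_mat ((r + 1) * d) ((r + 1) * d)"
    and blocks: "\<And>i. i < r \<Longrightarrow> mat_block d U i 0 = s \<cdot>\<^sub>m K i"
    using dil by (auto simp: kraus_dilation_def Let_def unitary_mat_def s_def c_def)
  have Kc: "K i \<in> carrier_mat d d" if "i < r" for i using K that by (simp add: kraus_operators_def)
  have \<Phi>: "\<Phi> \<rho> = sum_mats d r (\<lambda>i. K i * \<rho> * mat_adjoint (K i))"
    using K \<rho> by (simp add: kraus_operators_def)
  have "\<Phi> \<rho> = complex_of_real c \<cdot>\<^sub>m partial_trace (r + 1) d (outcome_operator d r U \<rho>)"
    unfolding \<Phi> partial_trace_outcome_operator[OF U \<rho>]
  proof (rule eq_matI)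
    let ?R = "complex_of_real c \<cdot>\<^sub>m sum_mats d r (\<lambda>i. mat_block d U i 0 * \<rho> * mat_adjoint (mat_block d U i 0))"
    fix a b assume "a < dim_row ?R" "b < dim_col ?R"
    then have ab: "a < d" "b < d" by simp_all
    have "(K i * \<rho> * mat_adjoint (K i)) $$ (a, b)
        = complex_of_real c * (mat_block d U i 0 * \<rho> * mat_adjoint (mat_block d U i 0)) $$ (a, b)" if i: "i < r" for i
    proof -
      have sK: "s \<cdot>\<^sub>m K i \<in> carrier_mat d d" using Kc[OF i] by simp
      have "(s \<cdot>\<^sub>m K i * \<rho> * mat_adjoint (s \<cdot>\<^sub>m K i)) $$ (a, b) = (s * s) * (K i * \<rho> * mat_adjoint (K i)) $$ (a, b)"
        unfolding conjugation_entry[OF Kc[OF i] \<rho> ab] conjugation_entry[OF sK \<rho> ab] sum_distrib_left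
        using Kc[OF i] ab by (intro sum.cong refl) (simp add: s_real)
      then show ?thesis unfolding blocks[OF i] using cs by (simp flip: mult.assoc)
    qed
    then show "sum_mats d r (\<lambda>i. K i * \<rho> * mat_adjoint (K i)) $$ (a, b) = ?R $$ (a, b)"
      using ab by (simp add: index_sum_mats sum_distrib_left)
  qed simp_all
  then show ?thesis by (simp add: c_def)
qed

lemma mat_trace_mult_smult:
  assumes "A \<in> carrier_mat n n" "B \<in> carrier_mat n n"
  shows "mat_trace (A * (c \<cdot>\<^sub>m B)) = c * mat_trace (A * B)"
proof -
  have "A * (c \<cdot>\<^sub>m B) = c \<cdot>\<^sub>m (A * B)" using assms by (intro mult_smult_distrib)
  then show ?thesis using assms by (simp add: mat_trace_smult[of _ n])
qed

text \<open>The normalisation inside \<open>post_state\<close> cancels against the outcome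
  probability, leaving the trace of A against the reproduction formula.\<close>

lemma kraus_dilation_expectation:
  assumes K: "kraus_operators d \<Phi> r K" and dil: "kraus_dilation d r K Kinf U" and \<rho>: "\<rho> \<in> carrier_mat d d"
    and p: "outcome_prob d r U \<rho> \<noteq> 0" and A: "A \<in> carrier_mat d d"
  shows "mat_trace (A * \<Phi> \<rho>)
    = complex_of_real (kraus_scale d r K) * outcome_prob d r U \<rho> * mat_trace (A * post_state d r U \<rho>)"
  unfolding kraus_dilation_reproduces[OF K dil \<rho>] post_state_def
  using p A by (simp add: mat_trace_mult_smult[of _ d])

lemma density_operatorD:
  assumes "density_operator d \<rho>"
  shows "\<rho> \<in> carrier_mat d d" "positive_mat d \<rho>" "mat_trace \<rho> = 1"
  using assms by (auto simp: density_operator_def positive_mat_def)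

lemma outcome_operator_positive:
  assumes U: "U \<in> carrier_mat ((r + 1) * d) ((r + 1) * d)" and \<rho>: "density_operator d \<rho>"
  shows "positive_mat d (partial_trace (r + 1) d (outcome_operator d r U \<rho>))"
  unfolding partial_trace_outcome_operator[OF U density_operatorD(1)[OF \<rho>]]
  by (intro positive_mat_sum_mats positive_mat_conjugation[of d] density_operatorD(2)[OF \<rho>]) simp

lemma outcome_prob_eq:
  "outcome_prob d r U \<rho> = mat_trace (partial_trace (r + 1) d (outcome_operator d r U \<rho>))"
  unfolding outcome_prob_def by (rule mat_trace_partial_trace[OF outcome_operator_carrier, symmetric])

text \<open>The lower bound is positivity of the unnormalised reduced state. For the upper one, the
  completeness relation splits the trace 1 of \<rho> into p and the trace of \<rho> conjugated by
  \<open>Kinf\<close>, which is the weight of the other outcome. In the order on complex numbers the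
  bounds include that p is real.\<close>

lemma outcome_prob_bounds:
  assumes K: "kraus_operators d \<Phi> r K" and dil: "kraus_dilation d r K Kinf U" and \<rho>: "density_operator d \<rho>"
  shows "0 \<le> outcome_prob d r U \<rho>" "outcome_prob d r U \<rho> \<le> 1"
proof -
  define c where "c = kraus_scale d r K"
  define G where "G = kraus_gram d r K"
  have "c > 0" using kraus_scale_bounds(1)[of d r K] by (simp add: c_def)
  note \<rho>c = density_operatorD(1)[OF \<rho>]
  have U: "U \<in> carrier_mat ((r + 1) * d) ((r + 1) * d)" and Kinf: "Kinf \<in> carrier_mat d d"
    and complete: "complex_of_real (1 / c) \<cdot>\<^sub>m G + mat_adjoint Kinf * Kinf = 1\<^sub>m d"
    using dil by (auto simp: kraus_dilation_def Let_def unitary_mat_def c_def G_def)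
  have Kc: "K i \<in> carrier_mat d d" if "i < r" for i using K that by (simp add: kraus_operators_def)
  have G: "G \<in> carrier_mat d d" by (simp add: G_def kraus_gram_def)
  show "0 \<le> outcome_prob d r U \<rho>"
    unfolding outcome_prob_eq by (rule mat_trace_nonneg[OF outcome_operator_positive[OF U \<rho>]])
  \<comment> \<open>Cyclicity of the trace, applied to each Kraus operator separately.\<close>
  have trG: "mat_trace (G * \<rho>) = mat_trace (\<Phi> \<rho>)"
  proof -
    have "mat_trace (G * \<rho>) = (\<Sum>i<r. mat_trace (mat_adjoint (K i) * K i * \<rho>))"
    proof -
      have "G * \<rho> = sum_mats d r (\<lambda>i. mat_adjoint (K i) * K i * \<rho>)"
      proof (rule eq_matI)
        fix a b assume "a < dim_row (sum_mats d r (\<lambda>i. mat_adjoint (K i) * K i * \<rho>))"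
          "b < dim_col (sum_mats d r (\<lambda>i. mat_adjoint (K i) * K i * \<rho>))"
        then have ab: "a < d" "b < d" by simp_all
        have "(G * \<rho>) $$ (a, b) = (\<Sum>k<d. \<Sum>i<r. (mat_adjoint (K i) * K i) $$ (a, k) * \<rho> $$ (k, b))"
          unfolding index_mult_mat_sum[OF G \<rho>c ab]
          using ab by (intro sum.cong refl) (simp add: G_def kraus_gram_def index_sum_mats sum_distrib_right
              del: index_mult_mat(1))
        also have "\<dots> = (\<Sum>i<r. \<Sum>k<d. (mat_adjoint (K i) * K i) $$ (a, k) * \<rho> $$ (k, b))"
          by (rule sum.swap)
        also have "\<dots> = (\<Sum>i<r. (mat_adjoint (K i) * K i * \<rho>) $$ (a, b))"
          using Kc \<rho>c ab by (intro sum.cong refl index_mult_mat_sum[symmetric]) (auto intro!: mult_carrier_mat[of _ d d])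
        finally show "(G * \<rho>) $$ (a, b) = sum_mats d r (\<lambda>i. mat_adjoint (K i) * K i * \<rho>) $$ (a, b)"
          using ab by (simp add: index_sum_mats del: index_mult_mat(1))
      qed (use G \<rho>c in auto)
      then show ?thesis
        using Kc \<rho>c by (simp add: mat_trace_sum_mats mult_carrier_mat[of _ d d])
    qed
    also have "\<dots> = (\<Sum>i<r. mat_trace (K i * \<rho> * mat_adjoint (K i)))"
      using Kc \<rho>c by (intro sum.cong refl mat_trace_conjugation[symmetric]) auto
    also have "\<dots> = mat_trace (sum_mats d r (\<lambda>i. K i * \<rho> * mat_adjoint (K i)))"
      using Kc \<rho>c by (intro mat_trace_sum_mats[symmetric]) (auto intro!: mult_carrier_mat[of _ d d])
    also have "\<dots> = mat_trace (\<Phi> \<rho>)" using K \<rho>c by (simp add: kraus_operators_def)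
    finally show ?thesis .
  qed
  have "1 = mat_trace ((complex_of_real (1 / c) \<cdot>\<^sub>m G + mat_adjoint Kinf * Kinf) * \<rho>)"
    unfolding complete using \<rho>c density_operatorD(3)[OF \<rho>] by simp
  also have "(complex_of_real (1 / c) \<cdot>\<^sub>m G + mat_adjoint Kinf * Kinf) * \<rho>
      = complex_of_real (1 / c) \<cdot>\<^sub>m (G * \<rho>) + mat_adjoint Kinf * Kinf * \<rho>"
    using G Kinf \<rho>c by (subst add_mult_distrib_mat[of _ d d]) (auto intro: mult_carrier_mat)
  also have "mat_trace \<dots> = complex_of_real (1 / c) * mat_trace (\<Phi> \<rho>)
      + mat_trace (Kinf * \<rho> * mat_adjoint Kinf)"
    unfolding mat_trace_conjugation[OF Kinf \<rho>c] trG[symmetric]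
    using G Kinf \<rho>c by (subst mat_trace_add[of _ d]) (auto simp: mat_trace_smult[of _ d] intro!: mult_carrier_mat[of _ d d])
  also have "mat_trace (\<Phi> \<rho>) = complex_of_real c * outcome_prob d r U \<rho>"
    unfolding outcome_prob_eq kraus_dilation_reproduces[OF K dil \<rho>c] c_def
    by (rule mat_trace_smult[of _ d]) simp
  finally have "1 = outcome_prob d r U \<rho> + mat_trace (Kinf * \<rho> * mat_adjoint Kinf)"
    using \<open>c > 0\<close> by simp
  moreover have "0 \<le> mat_trace (Kinf * \<rho> * mat_adjoint Kinf)"
    by (intro mat_trace_nonneg[of d] positive_mat_conjugation[of d] Kinf density_operatorD(2)[OF \<rho>])
  ultimately show "outcome_prob d r U \<rho> \<le> 1" by (metis le_add_same_cancel1)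
qed

lemma post_state_density:
  assumes U: "U \<in> carrier_mat ((r + 1) * d) ((r + 1) * d)" and \<rho>: "density_operator d \<rho>"
    and p: "outcome_prob d r U \<rho> > 0"
  shows "density_operator d (post_state d r U \<rho>)"
proof -
  have "0 \<le> 1 / outcome_prob d r U \<rho>" using p by (simp add: less_eq_complex_def less_complex_def Re_divide Im_divide)
  then have "positive_mat d (post_state d r U \<rho>)"
    unfolding post_state_def by (rule positive_mat_smult[OF outcome_operator_positive[OF U \<rho>]])
  moreover have "mat_trace (post_state d r U \<rho>) = 1"
    unfolding post_state_def using p
    by (subst mat_trace_smult[of _ d]) (auto simp: outcome_prob_eq)
  ultimately show ?thesis by (simp add: density_operator_def)
qed

section \<open>Kraus operators from the Choi matrix\<close>

text \<open>Block (i, j) is the image of |i><j|; equivalently, this is the ampliation of \<Phi>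
  evaluated on the unnormalised projector onto the maximally entangled vector.\<close>

definition choi_mat :: "nat \<Rightarrow> (complex mat \<Rightarrow> complex mat) \<Rightarrow> complex mat" where
  "choi_mat d \<Phi> = mat (d * d) (d * d)
     (\<lambda>(k, l). \<Phi> (ket_bra d (k div d) (l div d)) $$ (k mod d, l mod d))"

lemma choi_mat_carrier [simp]: "choi_mat d \<Phi> \<in> carrier_mat (d * d) (d * d)"
  by (simp add: choi_mat_def)

lemma ket_bra_carrier [simp]: "ket_bra d i j \<in> carrier_mat d d"
  by (simp add: ket_bra_def)

lemma choi_mat_entry:
  assumes "i < d" "a < d" "j < d" "b < d"
  shows "choi_mat d \<Phi> $$ (i * d + a, j * d + b) = \<Phi> (ket_bra d i j) $$ (a, b)"
  using assms block_index_less[OF assms(1,2)] block_index_less[OF assms(3,4)] by (simp add: choi_mat_def)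

lemma linear_superopD:
  assumes "linear_superop d \<Phi>"
  shows "X \<in> carrier_mat d d \<Longrightarrow> \<Phi> X \<in> carrier_mat d d"
    and "X \<in> carrier_mat d d \<Longrightarrow> Y \<in> carrier_mat d d \<Longrightarrow> \<Phi> (X + Y) = \<Phi> X + \<Phi> Y"
    and "X \<in> carrier_mat d d \<Longrightarrow> \<Phi> (a \<cdot>\<^sub>m X) = a \<cdot>\<^sub>m \<Phi> X"
  using assms by (simp_all add: linear_superop_def)

lemma linear_superop_sum_mats:
  assumes \<Phi>: "linear_superop d \<Phi>" and F: "\<And>k. F k \<in> carrier_mat d d"
  shows "\<Phi> (sum_mats d m F) = sum_mats d m (\<lambda>k. \<Phi> (F k))"
proof (induction m)
  case 0
  \<comment> \<open>The empty sum is written as 0 times a matrix, so that homogeneity evaluates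
    \<Phi> on it.\<close>
  have zero: "sum_mats d 0 G = 0 \<cdot>\<^sub>m X" if "X \<in> carrier_mat d d" for G X
    using that by (intro eq_matI) (auto simp: index_sum_mats)
  have "\<Phi> (sum_mats d 0 F) = \<Phi> (0 \<cdot>\<^sub>m 1\<^sub>m d)" by (simp add: zero[of "1\<^sub>m d"])
  also have "\<dots> = 0 \<cdot>\<^sub>m \<Phi> (1\<^sub>m d)" by (rule linear_superopD(3)[OF \<Phi>]) simp
  also have "\<dots> = sum_mats d 0 (\<lambda>k. \<Phi> (F k))"
    by (rule zero[symmetric]) (simp add: linear_superopD(1)[OF \<Phi>])
  finally show ?case .
next
  case (Suc m)
  have step: "sum_mats d (Suc m) G = sum_mats d m G + G m" if "G m \<in> carrier_mat d d" for G
    using that by (intro eq_matI) (auto simp: index_sum_mats)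
  have "\<Phi> (sum_mats d (Suc m) F) = \<Phi> (sum_mats d m F) + \<Phi> (F m)"
    unfolding step[of F, OF F] by (rule linear_superopD(2)[OF \<Phi>]) (simp_all add: F)
  then show ?case
    unfolding Suc.IH by (subst step) (simp_all add: F linear_superopD(1)[OF \<Phi>])
qed

text \<open>Expanding X in matrix units shows that a linear map is determined by the entries of its
  Choi matrix.\<close>

lemma linear_superop_entry:
  assumes \<Phi>: "linear_superop d \<Phi>" and X: "X \<in> carrier_mat d d" and ab: "a < d" "b < d"
  shows "\<Phi> X $$ (a, b) = (\<Sum>i<d. \<Sum>j<d. X $$ (i, j) * \<Phi> (ket_bra d i j) $$ (a, b))"
proof -
  \<comment> \<open>The d * d matrix units are enumerated by one index k, read as the pair (k div d,
    k mod d), so that additivity over a single \<open>sum_mats\<close> applies.\<close>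
  define F where "F = (\<lambda>k. X $$ (k div d, k mod d) \<cdot>\<^sub>m ket_bra d (k div d) (k mod d))"
  have F: "F k \<in> carrier_mat d d" for k by (simp add: F_def)
  have F_block: "F (i * d + j) = X $$ (i, j) \<cdot>\<^sub>m ket_bra d i j" if "j < d" for i j
    using that by (simp add: F_def)
  have expand: "X = sum_mats d (d * d) F"
  proof (rule eq_matI)
    fix p q assume "p < dim_row (sum_mats d (d * d) F)" "q < dim_col (sum_mats d (d * d) F)"
    then have pq: "p < d" "q < d" by simp_all
    have "sum_mats d (d * d) F $$ (p, q) = (\<Sum>i<d. \<Sum>j<d. F (i * d + j) $$ (p, q))"
      using pq by (simp add: index_sum_mats sum_blocks)
    also have "\<dots> = (\<Sum>i<d. if i = p then \<Sum>j<d. if j = q then X $$ (p, q) else 0 else 0)"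
    proof (rule sum.cong[OF refl])
      fix i
      have "(\<Sum>j<d. F (i * d + j) $$ (p, q)) = (\<Sum>j<d. if i = p then if j = q then X $$ (p, q) else 0 else 0)"
        using pq by (intro sum.cong refl) (auto simp: F_block ket_bra_def)
      then show "(\<Sum>j<d. F (i * d + j) $$ (p, q)) = (if i = p then \<Sum>j<d. if j = q then X $$ (p, q) else 0 else 0)"
        by (cases "i = p") simp_all
    qed
    also have "\<dots> = X $$ (p, q)" using pq by simp
    finally show "X $$ (p, q) = sum_mats d (d * d) F $$ (p, q)" ..
  qed (use X in auto)
  have "\<Phi> X = sum_mats d (d * d) (\<lambda>k. \<Phi> (F k))"
    by (subst expand) (rule linear_superop_sum_mats[OF \<Phi> F])
  then have "\<Phi> X $$ (a, b) = (\<Sum>i<d. \<Sum>j<d. \<Phi> (F (i * d + j)) $$ (a, b))"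
    using ab by (simp add: index_sum_mats sum_blocks)
  also have "\<dots> = (\<Sum>i<d. \<Sum>j<d. X $$ (i, j) * \<Phi> (ket_bra d i j) $$ (a, b))"
  proof (intro sum.cong refl)
    fix i j assume "i \<in> {..<d}" "j \<in> {..<d}"
    then have "\<Phi> (F (i * d + j)) = X $$ (i, j) \<cdot>\<^sub>m \<Phi> (ket_bra d i j)"
      by (simp add: F_block linear_superopD(3)[OF \<Phi>])
    then show "\<Phi> (F (i * d + j)) $$ (a, b) = X $$ (i, j) * \<Phi> (ket_bra d i j) $$ (a, b)"
      using ab carrier_matD[OF linear_superopD(1)[OF \<Phi> ket_bra_carrier]] by simp
  qed
  finally show ?thesis .
qed

text \<open>Row m of W, conjugated and reshaped into a d x d matrix, is the m-th Kraus operator. The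
  conjugation is forced: in the Gram matrix the conjugate falls on the factor with index (i, a),
  whereas in K |i><j| followed by the adjoint of K it falls on the one with index (j, b).\<close>

lemma kraus_operators_of_choi_gram:
  assumes \<Phi>: "linear_superop d \<Phi>" and W: "W \<in> carrier_mat (d * d) (d * d)"
    and gram: "mat_adjoint W * W = choi_mat d \<Phi>"
  shows "kraus_operators d \<Phi> (d\<^sup>2) (\<lambda>m. mat d d (\<lambda>(a, i). cnj (W $$ (m, i * d + a))))"
proof -
  define K where "K = (\<lambda>m. mat d d (\<lambda>(a, i). cnj (W $$ (m, i * d + a))))"
  have K: "K m \<in> carrier_mat d d" for m by (simp add: K_def)
  have "\<Phi> X = sum_mats d (d\<^sup>2) (\<lambda>m. K m * X * mat_adjoint (K m))" if X: "X \<in> carrier_mat d d" for X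
  proof (rule eq_matI)
    let ?R = "sum_mats d (d\<^sup>2) (\<lambda>m. K m * X * mat_adjoint (K m))"
    fix a b assume "a < dim_row ?R" "b < dim_col ?R"
    then have ab: "a < d" "b < d" by simp_all
    have entry: "\<Phi> (ket_bra d i j) $$ (a, b) = (\<Sum>m<d\<^sup>2. K m $$ (a, i) * cnj (K m $$ (b, j)))"
      if "i < d" "j < d" for i j
    proof -
      note less = block_index_less[OF that(1) ab(1)] block_index_less[OF that(2) ab(2)]
      have "\<Phi> (ket_bra d i j) $$ (a, b) = (mat_adjoint W * W) $$ (i * d + a, j * d + b)"
        unfolding gram using that ab by (simp add: choi_mat_entry)
      also have "\<dots> = (\<Sum>m<d * d. mat_adjoint W $$ (i * d + a, m) * W $$ (m, j * d + b))"
        using less W by (intro index_mult_mat_sum) auto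
      also have "\<dots> = (\<Sum>m<d\<^sup>2. K m $$ (a, i) * cnj (K m $$ (b, j)))"
        unfolding power2_eq_square using less W that ab by (intro sum.cong refl) (simp add: K_def)
      finally show ?thesis .
    qed
    have "\<Phi> X $$ (a, b) = (\<Sum>i<d. \<Sum>j<d. \<Sum>m<d\<^sup>2. K m $$ (a, i) * X $$ (i, j) * cnj (K m $$ (b, j)))"
      unfolding linear_superop_entry[OF \<Phi> X ab]
      by (intro sum.cong refl) (simp add: entry sum_distrib_left mult_ac)
    also have "\<dots> = (\<Sum>i<d. \<Sum>m<d\<^sup>2. \<Sum>j<d. K m $$ (a, i) * X $$ (i, j) * cnj (K m $$ (b, j)))"
      by (intro sum.cong refl sum.swap)
    also have "\<dots> = (\<Sum>m<d\<^sup>2. \<Sum>i<d. \<Sum>j<d. K m $$ (a, i) * X $$ (i, j) * cnj (K m $$ (b, j)))"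
      by (rule sum.swap)
    also have "\<dots> = ?R $$ (a, b)"
      unfolding index_sum_mats[OF ab] conjugation_entry[OF K X ab] ..
    finally show "\<Phi> X $$ (a, b) = ?R $$ (a, b)" .
  qed (use linear_superopD(1)[OF \<Phi> X] in auto)
  then show ?thesis
    unfolding K_def[symmetric] using K by (simp add: kraus_operators_def)
qed

text \<open>The ampliation is again in Kraus form, with operators 1 \<otimes> K m, and both
  conjugations and sums preserve positivity.\<close>

lemma completely_positive_of_kraus:
  assumes \<Phi>: "linear_superop d \<Phi>" and K: "kraus_operators d \<Phi> r K"
  shows "completely_positive d \<Phi>"
proof -
  have Kc: "K m \<in> carrier_mat d d" if "m < r" for m using K that by (simp add: kraus_operators_def)
  have "positive_mat (n * d) (ampliation n d \<Phi> X)" if pos: "positive_mat (n * d) X" for n X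
  proof -
    have X: "X \<in> carrier_mat (n * d) (n * d)" using pos by (simp add: positive_mat_def)
    \<comment> \<open>This is 1 \<otimes> K m: n copies of K m along the diagonal. Each row lives in
      one block, which \<open>L_row\<close> exploits.\<close>
    define L where "L = (\<lambda>m. mat (n * d) (n * d)
      (\<lambda>(k, l). if k div d = l div d then K m $$ (k mod d, l mod d) else 0))"
    have L: "L m \<in> carrier_mat (n * d) (n * d)" for m by (simp add: L_def)
    have L_row: "(\<Sum>l<n * d. L m $$ (k, l) * f l) = (\<Sum>p<d. K m $$ (k mod d, p) * f (k div d * d + p))"
      if k: "k < n * d" for m k and f :: "nat \<Rightarrow> complex"
    proof -
      have kd: "k div d < n" using k by (simp only: less_mult_imp_div_less)
      have "(\<Sum>l<n * d. L m $$ (k, l) * f l)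
          = (\<Sum>i<n. if i = k div d then \<Sum>p<d. K m $$ (k mod d, p) * f (k div d * d + p) else 0)"
        unfolding sum_blocks
      proof (rule sum.cong[OF refl])
        fix i assume "i \<in> {..<n}"
        then have "L m $$ (k, i * d + p) = (if i = k div d then K m $$ (k mod d, p) else 0)" if "p < d" for p
          using that k block_index_less[of i n p d] by (auto simp: L_def)
        then have "(\<Sum>p<d. L m $$ (k, i * d + p) * f (i * d + p))
            = (\<Sum>p<d. (if i = k div d then K m $$ (k mod d, p) else 0) * f (i * d + p))"
          by (intro sum.cong refl) simp
        then show "(\<Sum>p<d. L m $$ (k, i * d + p) * f (i * d + p))
            = (if i = k div d then \<Sum>p<d. K m $$ (k mod d, p) * f (k div d * d + p) else 0)"
          by (cases "i = k div d") simp_all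
      qed
      then show ?thesis using kd by simp
    qed
    have "ampliation n d \<Phi> X = sum_mats (n * d) r (\<lambda>m. L m * X * mat_adjoint (L m))"
    proof (rule eq_matI)
      let ?R = "sum_mats (n * d) r (\<lambda>m. L m * X * mat_adjoint (L m))"
      fix k l assume "k < dim_row ?R" "l < dim_col ?R"
      then have kl: "k < n * d" "l < n * d" by simp_all
      then have "d > 0" by (cases d) auto
      then have md: "k mod d < d" "l mod d < d" by simp_all
      let ?Y = "mat_block d X (k div d) (l div d)"
      have conj: "(L m * X * mat_adjoint (L m)) $$ (k, l) = (K m * ?Y * mat_adjoint (K m)) $$ (k mod d, l mod d)"
        if m: "m < r" for m
      proof -
        have "(L m * X * mat_adjoint (L m)) $$ (k, l)
            = (\<Sum>p<n * d. \<Sum>q<n * d. L m $$ (k, p) * X $$ (p, q) * cnj (L m $$ (l, q)))"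
          by (rule conjugation_entry[OF L X kl])
        \<comment> \<open>The inner sum is written as the conjugate of a row sum of L m, so that
          \<open>L_row\<close> collapses both sums.\<close>
        also have "\<dots> = (\<Sum>p<n * d. L m $$ (k, p) * cnj (\<Sum>q<n * d. L m $$ (l, q) * cnj (X $$ (p, q))))"
          by (simp add: sum_distrib_left mult_ac)
        also have "\<dots> = (\<Sum>p<d. K m $$ (k mod d, p)
            * cnj (\<Sum>q<d. K m $$ (l mod d, q) * cnj (X $$ (k div d * d + p, l div d * d + q))))"
          unfolding L_row[OF kl(2)] L_row[OF kl(1)] ..
        also have "\<dots> = (\<Sum>p<d. \<Sum>q<d. K m $$ (k mod d, p) * ?Y $$ (p, q) * cnj (K m $$ (l mod d, q)))"
          by (simp add: sum_distrib_left mult_ac index_mat_block)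
        also have "\<dots> = (K m * ?Y * mat_adjoint (K m)) $$ (k mod d, l mod d)"
          by (rule conjugation_entry[OF Kc[OF m] mat_block_carrier md, symmetric])
        finally show ?thesis .
      qed
      have "ampliation n d \<Phi> X $$ (k, l) = \<Phi> ?Y $$ (k mod d, l mod d)"
        using kl by (simp add: ampliation_def)
      also have "\<dots> = (\<Sum>m<r. (K m * ?Y * mat_adjoint (K m)) $$ (k mod d, l mod d))"
        using K md by (simp add: kraus_operators_def index_sum_mats)
      also have "\<dots> = (\<Sum>m<r. (L m * X * mat_adjoint (L m)) $$ (k, l))"
        by (intro sum.cong refl conj[symmetric]) simp
      finally show "ampliation n d \<Phi> X $$ (k, l) = ?R $$ (k, l)"
        using kl by (simp only: index_sum_mats)
    qed (simp_all add: ampliation_def)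
    then show ?thesis
      using positive_mat_sum_mats[of r "n * d"] positive_mat_conjugation[OF pos L] by simp
  qed
  then show ?thesis using \<Phi> by (simp add: completely_positive_def)
qed

section \<open>Splitting a Hermiticity-preserving map\<close>

lemma hermitian_mat_entry:
  assumes "hermitian_mat H" "H \<in> carrier_mat d d" "a < d" "b < d"
  shows "H $$ (a, b) = cnj (H $$ (b, a))"
  using assms index_mat_adjoint[of a H b] by (simp add: hermitian_mat_def)

text \<open>
  \<open>|i\<rangle>\<langle>j|\<close> is not Hermitian, but \<open>|i\<rangle>\<langle>j| + |j\<rangle>\<langle>i|\<close> and \<open>\<i> (|i\<rangle>\<langle>j| - |j\<rangle>\<langle>i|)\<close> are.
\<close>

lemma hermiticity_preserving_ket_bra:
  assumes T: "linear_superop d T" "hermiticity_preserving d T" and ab: "a < d" "b < d"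
  shows "T (ket_bra d i j) $$ (a, b) = cnj (T (ket_bra d j i) $$ (b, a))"
proof -
  let ?E = "ket_bra d i j" and ?F = "ket_bra d j i"
  note Tc = linear_superopD(1)[OF T(1) ket_bra_carrier]
  have entries: "T (x \<cdot>\<^sub>m ?E + y \<cdot>\<^sub>m ?F) $$ (p, q) = x * T ?E $$ (p, q) + y * T ?F $$ (p, q)"
    if "p < d" "q < d" for x y p q
    using that carrier_matD[OF Tc]
    by (simp add: linear_superopD(2,3)[OF T(1)])
  \<comment> \<open>One family covers both Hermitian combinations: x = 1 gives the sum and x =
    \<open>\<i>\<close> gives \<open>\<i>\<close> times the difference.\<close>
  have herm: "T (x \<cdot>\<^sub>m ?E + cnj x \<cdot>\<^sub>m ?F) $$ (a, b) = cnj (T (x \<cdot>\<^sub>m ?E + cnj x \<cdot>\<^sub>m ?F) $$ (b, a))" for x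
  proof (rule hermitian_mat_entry[OF _ _ ab])
    define M where "M = x \<cdot>\<^sub>m ?E + cnj x \<cdot>\<^sub>m ?F"
    have M: "dim_row M = d" "dim_col M = d" by (simp_all add: M_def ket_bra_def)
    have swap: "?F $$ (p, q) = ?E $$ (q, p)" "?E $$ (p, q) = ?F $$ (q, p)"
        "cnj (?E $$ (p, q)) = ?E $$ (p, q)" "cnj (?F $$ (p, q)) = ?F $$ (p, q)"
      if "p < d" "q < d" for p q
      using that by (simp_all add: ket_bra_def conj_commute)
    have M_entry: "M $$ (p, q) = x * ?E $$ (p, q) + cnj x * ?F $$ (p, q)" if "p < d" "q < d" for p q
      using that by (simp add: M_def carrier_matD[OF ket_bra_carrier])
    have "hermitian_mat M"
      unfolding hermitian_mat_def
    proof (rule eq_matI)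
      fix p q assume "p < dim_row M" "q < dim_col M"
      then have pq: "p < d" "q < d" by (simp_all add: M)
      have "mat_adjoint M $$ (p, q) = cnj (M $$ (q, p))" using pq by (intro index_mat_adjoint) (simp_all add: M)
      also have "\<dots> = cnj x * ?E $$ (q, p) + x * ?F $$ (q, p)"
        using swap(3,4)[OF pq(2,1)] by (simp only: M_entry[OF pq(2,1)] complex_cnj_add complex_cnj_mult complex_cnj_cnj)
      also have "\<dots> = M $$ (p, q)" unfolding M_entry[OF pq] swap(1,2)[OF pq] by (rule add.commute)
      finally show "mat_adjoint M $$ (p, q) = M $$ (p, q)" .
    qed (simp_all add: M)
    then have "hermitian_mat (x \<cdot>\<^sub>m ?E + cnj x \<cdot>\<^sub>m ?F)" unfolding M_def .
    then show "hermitian_mat (T (x \<cdot>\<^sub>m ?E + cnj x \<cdot>\<^sub>m ?F))"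
      using T(2) by (simp add: hermiticity_preserving_def)
  qed (simp add: linear_superopD(1)[OF T(1)])
  \<comment> \<open>Dividing the instance x = \<open>\<i>\<close> by \<open>\<i>\<close> and adding
    the instance x = 1 eliminates the entry (a, b) of T ?F and the entry (b, a) of T ?E.\<close>
  have "2 * T ?E $$ (a, b) = 2 * cnj (T ?F $$ (b, a))"
    using herm[of 1] herm[of \<i>] unfolding entries[OF ab] entries[OF ab(2,1)]
    by (simp add: complex_eq_iff)
  then show ?thesis by simp
qed

lemma choi_mat_hermitian:
  assumes "linear_superop d T" "hermiticity_preserving d T"
  shows "hermitian_mat (choi_mat d T)"
  unfolding hermitian_mat_def
proof (rule eq_matI)
  fix k l assume "k < dim_row (choi_mat d T)" "l < dim_col (choi_mat d T)"
  then have kl: "k < d * d" "l < d * d" by (simp_all add: choi_mat_def)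
  then have "d > 0" by (cases d) auto
  then have "k mod d < d" "l mod d < d" by simp_all
  then show "mat_adjoint (choi_mat d T) $$ (k, l) = choi_mat d T $$ (k, l)"
    using kl hermiticity_preserving_ket_bra[OF assms, of "k mod d" "l mod d" "k div d" "l div d"]
    by (simp add: choi_mat_def)
qed (simp_all add: choi_mat_def)

text \<open>The map b T + a Tr(.) 1. Keeping both coefficients lets b = 1 and b = 0 give the two
  parts of the splitting, so that linearity, Choi matrix and Kraus operators are treated
  once.\<close>

definition depolarizing_shift ::
  "nat \<Rightarrow> (complex mat \<Rightarrow> complex mat) \<Rightarrow> real \<Rightarrow> real \<Rightarrow> complex mat \<Rightarrow> complex mat" where
  "depolarizing_shift d T a b X = complex_of_real b \<cdot>\<^sub>m T X + (complex_of_real a * mat_trace X) \<cdot>\<^sub>m 1\<^sub>m d"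

lemma linear_depolarizing_shift:
  assumes "linear_superop d T"
  shows "linear_superop d (depolarizing_shift d T a b)"
  unfolding linear_superop_def depolarizing_shift_def
proof (intro conjI ballI allI)
  fix X Y :: "complex mat" and c assume X: "X \<in> carrier_mat d d"
  note TX = linear_superopD(1)[OF assms X]
  show "complex_of_real b \<cdot>\<^sub>m T X + (complex_of_real a * mat_trace X) \<cdot>\<^sub>m 1\<^sub>m d \<in> carrier_mat d d" by simp
  show "complex_of_real b \<cdot>\<^sub>m T (c \<cdot>\<^sub>m X) + (complex_of_real a * mat_trace (c \<cdot>\<^sub>m X)) \<cdot>\<^sub>m 1\<^sub>m d
      = c \<cdot>\<^sub>m (complex_of_real b \<cdot>\<^sub>m T X + (complex_of_real a * mat_trace X) \<cdot>\<^sub>m 1\<^sub>m d)"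
    unfolding linear_superopD(3)[OF assms X] mat_trace_smult[OF X]
    using TX by (intro eq_matI) (auto simp: algebra_simps)
  assume Y: "Y \<in> carrier_mat d d"
  note TY = linear_superopD(1)[OF assms Y]
  show "complex_of_real b \<cdot>\<^sub>m T (X + Y) + (complex_of_real a * mat_trace (X + Y)) \<cdot>\<^sub>m 1\<^sub>m d
      = (complex_of_real b \<cdot>\<^sub>m T X + (complex_of_real a * mat_trace X) \<cdot>\<^sub>m 1\<^sub>m d)
        + (complex_of_real b \<cdot>\<^sub>m T Y + (complex_of_real a * mat_trace Y) \<cdot>\<^sub>m 1\<^sub>m d)"
    unfolding linear_superopD(2)[OF assms X Y] mat_trace_add[OF X Y]
    using TX TY by (intro eq_matI) (auto simp: algebra_simps)
qed

text \<open>The trace of |i><j| is nonzero only for i = j, where it contributes an identity block;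
  hence Tr(.) 1 has the identity as its Choi matrix.\<close>

lemma choi_depolarizing_shift:
  assumes "linear_superop d T"
  shows "choi_mat d (depolarizing_shift d T a b)
    = complex_of_real a \<cdot>\<^sub>m 1\<^sub>m (d * d) + complex_of_real b \<cdot>\<^sub>m choi_mat d T"
proof (rule eq_matI)
  let ?R = "complex_of_real a \<cdot>\<^sub>m 1\<^sub>m (d * d) + complex_of_real b \<cdot>\<^sub>m choi_mat d T"
  fix k l assume "k < dim_row ?R" "l < dim_col ?R"
  then have kl: "k < d * d" "l < d * d" by (simp_all add: choi_mat_def)
  then have "d > 0" by (cases d) auto
  then have md: "k mod d < d" "l mod d < d" by simp_all
  have "k div d < d" using kl by (simp only: less_mult_imp_div_less)
  then have tr: "mat_trace (ket_bra d (k div d) (l div d)) = (if k div d = l div d then 1 else 0)"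
    by (cases "k div d = l div d") (simp_all add: mat_trace_def ket_bra_def)
  have "k = l \<longleftrightarrow> k div d = l div d \<and> k mod d = l mod d" by (metis div_mult_mod_eq)
  then have "(if k div d = l div d then 1 else 0) * (if k mod d = l mod d then 1 else 0)
      = (if k = l then 1 else 0 :: complex)" by (cases "k = l") auto
  then show "choi_mat d (depolarizing_shift d T a b) $$ (k, l) = ?R $$ (k, l)"
    using kl md carrier_matD[OF linear_superopD(1)[OF assms ket_bra_carrier]]
    by (simp add: choi_mat_def depolarizing_shift_def tr mult.assoc)
qed (simp_all add: choi_mat_def)

text \<open>The hypothesis on the eigenvalues expresses that the shifted Choi matrix is positive
  semidefinite.\<close>

lemma depolarizing_shift_kraus:
  assumes T: "linear_superop d T" "hermiticity_preserving d T"
    and nonneg: "\<And>x. eigenvalue (choi_mat d T) (complex_of_real x) \<Longrightarrow> 0 \<le> a + b * x"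
  shows "\<exists>K. kraus_operators d (depolarizing_shift d T a b) (d\<^sup>2) K"
proof -
  obtain W where "W \<in> carrier_mat (d * d) (d * d)"
    "mat_adjoint W * W = complex_of_real a \<cdot>\<^sub>m 1\<^sub>m (d * d) + complex_of_real b \<cdot>\<^sub>m choi_mat d T"
    using hermitian_affine_gram[OF choi_mat_carrier choi_mat_hermitian[OF T] nonneg] by blast
  then show ?thesis
    using kraus_operators_of_choi_gram[OF linear_depolarizing_shift[OF T(1)]]
    unfolding choi_depolarizing_shift[OF T(1)] by blast
qed

text \<open>The shifts cancel in the difference. The Kraus families are returned along with the maps
  so that dilations of both parts can be produced; their number d * d is the largest that
  \<open>kraus_operators\<close> admits.\<close>

lemma hermiticity_preserving_split:
  assumes T: "linear_superop d T" "hermiticity_preserving d T"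
  shows "\<exists>T0 T1 K0 K1. completely_positive d T0 \<and> completely_positive d T1 \<and>
    (\<forall>X \<in> carrier_mat d d. T X = T0 X - T1 X) \<and>
    kraus_operators d T0 (d\<^sup>2) K0 \<and> kraus_operators d T1 (d\<^sup>2) K1"
proof -
  let ?E = "{x. eigenvalue (choi_mat d T) (complex_of_real x)}"
  \<comment> \<open>The least nonnegative shift that makes all real eigenvalues of the Choi matrix
    nonnegative. Inserting 0 keeps the set nonempty and yields c \<ge> 0, the condition for the part
    with b = 0.\<close>
  define c where "c = Max (insert 0 (uminus ` ?E))"
  have fin: "finite (insert 0 (uminus ` ?E))"
    using finite_real_eigenvalues[OF choi_mat_carrier] by simp
  have c0: "0 \<le> c" unfolding c_def by (rule Max_ge[OF fin]) simp
  have c: "0 \<le> c + 1 * x" if "eigenvalue (choi_mat d T) (complex_of_real x)" for x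
  proof -
    have "- x \<le> c" unfolding c_def using that by (intro Max_ge[OF fin]) blast
    then show ?thesis by simp
  qed
  obtain K0 where K0: "kraus_operators d (depolarizing_shift d T c 1) (d\<^sup>2) K0"
    using depolarizing_shift_kraus[OF T, of c 1] c by blast
  obtain K1 where K1: "kraus_operators d (depolarizing_shift d T c 0) (d\<^sup>2) K1"
    using depolarizing_shift_kraus[OF T, of c 0] c0 by auto
  have "T X = depolarizing_shift d T c 1 X - depolarizing_shift d T c 0 X" if "X \<in> carrier_mat d d" for X
    using linear_superopD(1)[OF T(1) that] by (intro eq_matI) (auto simp: depolarizing_shift_def)
  then show ?thesis
    using K0 K1 completely_positive_of_kraus[OF linear_depolarizing_shift[OF T(1)]] by blast
qed

theorem mainTheorem3:
  fixes d :: nat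
  assumes "d \<ge> 1"
  shows
    "(\<forall>\<Phi> r K. completely_positive d \<Phi> \<and> kraus_operators d \<Phi> r K \<longrightarrow>
       (\<exists>Kinf U. kraus_dilation d r K Kinf U \<and>
         (\<forall>\<rho>. density_operator d \<rho> \<longrightarrow>
           (let c = complex_of_real (kraus_scale d r K);
                p = outcome_prob d r U \<rho>;
                \<rho>' = post_state d r U \<rho>
            in \<Phi> \<rho> = c \<cdot>\<^sub>m partial_trace (r + 1) d (outcome_operator d r U \<rho>) \<and>
               0 \<le> p \<and> p \<le> 1 \<and>
               (p > 0 \<longrightarrow>
                  density_operator d \<rho>' \<and>
                  (\<forall>A \<in> carrier_mat d d. mat_trace (A * \<Phi> \<rho>) = c * p * mat_trace (A * \<rho>')))))))
     \<and>
     (\<forall>T. linear_superop d T \<and> hermiticity_preserving d T \<and> trace_preserving d T \<longrightarrow>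
       (\<exists>T0 T1. completely_positive d T0 \<and> completely_positive d T1 \<and>
         (\<forall>X \<in> carrier_mat d d. T X = T0 X - T1 X) \<and>
         (\<exists>r K Kinf U. kraus_operators d T0 r K \<and> kraus_dilation d r K Kinf U) \<and>
         (\<exists>r K Kinf U. kraus_operators d T1 r K \<and> kraus_dilation d r K Kinf U) \<and>
         (\<forall>r0 K0 Kinf0 U0 r1 K1 Kinf1 U1.
            kraus_operators d T0 r0 K0 \<and> kraus_dilation d r0 K0 Kinf0 U0 \<and>
            kraus_operators d T1 r1 K1 \<and> kraus_dilation d r1 K1 Kinf1 U1 \<longrightarrow>
            (\<forall>\<rho>. density_operator d \<rho> \<longrightarrow>
              (let c0 = complex_of_real (kraus_scale d r0 K0);
                   p0 = outcome_prob d r0 U0 \<rho>;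
                   \<rho>0 = post_state d r0 U0 \<rho>;
                   c1 = complex_of_real (kraus_scale d r1 K1);
                   p1 = outcome_prob d r1 U1 \<rho>;
                   \<rho>1 = post_state d r1 U1 \<rho>
               in p0 > 0 \<and> p1 > 0 \<longrightarrow>
                  (\<forall>A \<in> carrier_mat d d.
                     mat_trace (A * T \<rho>) =
                       c0 * p0 * mat_trace (A * \<rho>0) - c1 * p1 * mat_trace (A * \<rho>1)))))))"
proof (intro conjI allI impI, goal_cases)
  case (1 \<Phi> r K)
  then have K: "kraus_operators d \<Phi> r K" by simp
  obtain Kinf U where dil: "kraus_dilation d r K Kinf U"
    using kraus_dilation_exists[of r K d] K by (auto simp: kraus_operators_def)
  have U: "U \<in> carrier_mat ((r + 1) * d) ((r + 1) * d)"
    using dil by (auto simp: kraus_dilation_def Let_def unitary_mat_def)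
  show ?case
  proof (rule exI[of _ Kinf], rule exI[of _ U], intro conjI allI impI)
    fix \<rho> assume \<rho>: "density_operator d \<rho>"
    note \<rho>c = density_operatorD(1)[OF \<rho>]
    show "let c = complex_of_real (kraus_scale d r K); p = outcome_prob d r U \<rho>; \<rho>' = post_state d r U \<rho>
      in \<Phi> \<rho> = c \<cdot>\<^sub>m partial_trace (r + 1) d (outcome_operator d r U \<rho>) \<and> 0 \<le> p \<and> p \<le> 1 \<and>
        (p > 0 \<longrightarrow> density_operator d \<rho>' \<and>
          (\<forall>A \<in> carrier_mat d d. mat_trace (A * \<Phi> \<rho>) = c * p * mat_trace (A * \<rho>')))"
      unfolding Let_def
      using kraus_dilation_reproduces[OF K dil \<rho>c] outcome_prob_bounds[OF K dil \<rho>]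
        post_state_density[OF U \<rho>] kraus_dilation_expectation[OF K dil \<rho>c]
      by (intro conjI impI ballI) (simp_all del: One_nat_def add_Suc_right)
  qed (rule dil)
next
  case (2 T)
  then obtain T0 T1 K0 K1 where cp: "completely_positive d T0" "completely_positive d T1"
    and split: "\<And>X. X \<in> carrier_mat d d \<Longrightarrow> T X = T0 X - T1 X"
    and K: "kraus_operators d T0 (d\<^sup>2) K0" "kraus_operators d T1 (d\<^sup>2) K1"
    using hermiticity_preserving_split[of d T] by metis
  \<comment> \<open>Existence of dilations guarantees that the universally quantified recovery
    formula has instances.\<close>
  have dil: "\<exists>r K Kinf U. kraus_operators d S r K \<and> kraus_dilation d r K Kinf U"
    if "kraus_operators d S (d\<^sup>2) K" for S K
    using that kraus_dilation_exists[of "d\<^sup>2" K d] by (auto simp: kraus_operators_def)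
  \<comment> \<open>The expectation formula holds for any Kraus family with any dilation of it, so
    the two parts may be implemented independently; linearity of the trace subtracts the
    results.\<close>
  have recover: "mat_trace (A * T \<rho>)
      = complex_of_real (kraus_scale d r0 K0') * outcome_prob d r0 U0 \<rho>
        * mat_trace (A * post_state d r0 U0 \<rho>)
      - complex_of_real (kraus_scale d r1 K1') * outcome_prob d r1 U1 \<rho>
        * mat_trace (A * post_state d r1 U1 \<rho>)"
    if "kraus_operators d T0 r0 K0'" "kraus_dilation d r0 K0' Kinf0 U0"
      "kraus_operators d T1 r1 K1'" "kraus_dilation d r1 K1' Kinf1 U1" "density_operator d \<rho>"
      "outcome_prob d r0 U0 \<rho> > 0" "outcome_prob d r1 U1 \<rho> > 0" "A \<in> carrier_mat d d"
    for r0 K0' Kinf0 U0 r1 K1' Kinf1 U1 \<rho> A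
  proof -
    note \<rho> = density_operatorD(1)[OF that(5)]
    have T01: "T0 \<rho> \<in> carrier_mat d d" "T1 \<rho> \<in> carrier_mat d d"
      using cp \<rho> by (auto simp: completely_positive_def linear_superop_def)
    have "mat_trace (A * T \<rho>) = mat_trace (A * T0 \<rho> - A * T1 \<rho>)"
      unfolding split[OF \<rho>] using T01 that(8) by (subst mult_minus_distrib_mat[of _ d d]) auto
    also have "\<dots> = mat_trace (A * T0 \<rho>) - mat_trace (A * T1 \<rho>)"
      using T01 that(8) by (intro mat_trace_minus[of _ d]) auto
    finally show ?thesis
      using kraus_dilation_expectation[OF that(1,2) \<rho> _ that(8)]
        kraus_dilation_expectation[OF that(3,4) \<rho> _ that(8)] that(6,7) by simp
  qed
  show ?case
    unfolding Let_def
  proof (rule exI[of _ T0], rule exI[of _ T1], intro conjI cp dil[OF K(1)] dil[OF K(2)], goal_cases)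
    case 1
    show ?case using split by blast
  next
    case 2
    show ?case using recover by blast
  qed
qed

end
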